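(* Let $E(q)=\prod_{k\ge1}(1-q^k)$, $$X=\frac{E(q^2)^4E(q^3)^8}{E(q)^8E(q^6)^4},\qquad \xi=q^{-2}\frac{E(q^2)^5E(q^9)^4}{E(q)^4E(q^{18})^5},$$ and let $U$ be the operator on formal Laurent series defined by $U\left(\sum_{n\ge n_0}a_nq^n\right)=\sum_{3n\ge n_0}a_{3n}q^n$. Define integer matrices $(a(i,j))_{i,j\ge1}$ and $(b(i,j))_{i,j\ge1}$ as follows. The first three rows are (entries listed for $j=1,2,\dots$; all further entries in these rows are $0$): \begin{itemize} \item $a(1,\cdot)=(10,-36,27)$; $a(2,\cdot)=(-8,306,-2160,5508,-5832,2187)$; $a(3,\cdot)=(1,-360,10566,-99144,423549,-944784,1141614,-708588,177147)$; \item $b(1,\cdot)=(-9,252,-891,729)$; $b(2,\cdot)=(1,-378,8613,-54675,138510,-150903,59049)$; $b(3,\cdot)=(0,147,-14553,312255,-2617839,10764414,-23914845,29288304,-18600435,4782969)$. \end{itemize} For $i\ge4$ and $j\ge1$, both $m=a$ and $m=b$ satisfy $$m(i,j)=30m(i-1,j-1)-108m(i-1,j-2)+81m(i-1,j-3)-12m(i-2,j-1)+9m(i-2,j-2)+m(i-3,j-1),$$ where $m(i,j)=0$ whenever $j\le 0$. Then for every $i\ge1$, $$U(X^i)=\sum_{j\ge1}a(i,j)X^j,\qquad U(\xi X^i)=\sum_{j\ge1}b(i,j)X^j.$$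
   Context: All identities are identities of formal Laurent series in $q$; each row of the matrices has only finitely many nonzero entries. *)

theory Defs
  imports "HOL-Computational_Algebra.Formal_Laurent_Series"
begin

text \<open>Euler's product E(q) = prod_{k>=1} (1 - q^k) as a formal power series over the
  rationals: its n-th coefficient is that of the finite product over k = 1..n
  (factors with k > n do not affect coefficients of degree at most n).\<close>
definition Eul :: "rat fps" where
  "Eul = Abs_fps (\<lambda>n. (\<Prod>k\<in>{1..n}. (1 - fps_X ^ k :: rat fps)) $ n)"

definition Eq :: "nat \<Rightarrow> rat fps" where
  "Eq m = fps_compose Eul (fps_X ^ m)"

definition Xfun :: "rat fls" where
  "Xfun = fps_to_fls (Eq 2 ^ 4 * Eq 3 ^ 8 * inverse (Eq 1 ^ 8 * Eq 6 ^ 4))"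

definition xi :: "rat fls" where
  "xi = fls_shift 2 (fps_to_fls (Eq 2 ^ 5 * Eq 9 ^ 4 * inverse (Eq 1 ^ 4 * Eq 18 ^ 5)))"

lift_definition Uop :: "'a::zero fls \<Rightarrow> 'a fls" is "\<lambda>f n. f (3 * n)"
proof -
  fix f :: "int \<Rightarrow> 'a"
  assume "\<forall>\<^sub>\<infinity> n::nat. f (- int n) = 0"
  then obtain N where N: "\<And>n. n > N \<Longrightarrow> f (- int n) = 0"
    by (auto simp: MOST_nat)
  have "\<And>n. n > N \<Longrightarrow> f (3 * - int n) = 0"
  proof -
    fix n :: nat assume "n > N"
    hence "3 * n > N" by simp
    from N[OF this] show "f (3 * - int n) = 0" by simp
  qed
  thus "\<forall>\<^sub>\<infinity> n::nat. f (3 * - int n) = 0"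
    by (auto simp: MOST_nat)
qed

definition init_row :: "int list list \<Rightarrow> nat \<Rightarrow> int \<Rightarrow> int" where
  "init_row rows i j =
     (if 1 \<le> i \<and> i \<le> length rows \<and> 1 \<le> j \<and> nat j \<le> length (rows ! (i - 1))
      then rows ! (i - 1) ! (nat j - 1) else 0)"

function recmat :: "int list list \<Rightarrow> nat \<Rightarrow> int \<Rightarrow> int" where
  "recmat rows i j =
     (if j \<le> 0 then 0
      else if i \<le> 3 then init_row rows i j
      else 30 * recmat rows (i - 1) (j - 1) - 108 * recmat rows (i - 1) (j - 2)
         + 81 * recmat rows (i - 1) (j - 3) - 12 * recmat rows (i - 2) (j - 1)
         + 9 * recmat rows (i - 2) (j - 2) + recmat rows (i - 3) (j - 1))"
  by auto
termination by (relation "measure (\<lambda>(rows, i, j). i)") auto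

definition amat :: "nat \<Rightarrow> int \<Rightarrow> int" where
  "amat = recmat [[10, -36, 27],
                  [-8, 306, -2160, 5508, -5832, 2187],
                  [1, -360, 10566, -99144, 423549, -944784, 1141614, -708588, 177147]]"

definition bmat :: "nat \<Rightarrow> int \<Rightarrow> int" where
  "bmat = recmat [[-9, 252, -891, 729],
                  [1, -378, 8613, -54675, 138510, -150903, 59049],
                  [0, 147, -14553, 312255, -2617839, 10764414, -23914845, 29288304,
                   -18600435, 4782969]]"

end

theory Submission
  imports Defs
begin

text \<open>
  Write \<open>\<phi>(-q) = E(q)\<^sup>2/E(q\<^sup>2)\<close> and \<open>\<psi>(q) = E(q\<^sup>2)\<^sup>2/E(q)\<close>. Splitting the theta series given by the Jacobi
  triple product according to the summation index modulo 3 yields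
  \<open>\<phi>(-q) = \<phi>(-q\<^sup>9) (1 - 2 p)\<close> and \<open>\<psi>(q) = q \<psi>(q\<^sup>9) (1 + p)/p\<close>, where \<open>p = q w(q\<^sup>3)\<close> and
  \<open>w = E(q) E(q\<^sup>6)\<^sup>3/(E(q\<^sup>2) E(q\<^sup>3)\<^sup>3)\<close>.
  Taking the norm (the product over \<open>q \<mapsto> \<omega> q\<close> with \<open>\<omega>\<^sup>3 = 1\<close>) of the first identity gives
  \<open>1 - 8 p\<^sup>3 = 1/Y\<close> with \<open>Y = X(q\<^sup>3)\<close>. As \<open>X = (\<phi>(-q\<^sup>3)/\<phi>(-q))\<^sup>4\<close>, it follows that
  \<open>X = (1 + 2 p + 4 p\<^sup>2)\<^sup>4 Y\<^sup>3\<close> and \<open>\<xi> = (1 + p)\<^sup>2/(p\<^sup>2 (1 - 2 p))\<close>. Eliminating \<open>p\<close> gives a cubic equation for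
  \<open>X\<close> over the polynomials in \<open>Y\<close>, which is the recurrence for the matrices because
  \<open>U(Y f) = X U(f)\<close>; the operator \<open>U\<close> itself keeps exactly the powers of \<open>p\<close> divisible by 3.
\<close>

subsection \<open>Limits and infinite products of formal power series\<close>

text \<open>Convergence of formal power series means that each coefficient is eventually constant;
  coefficient \<open>n\<close> of a product involves only the coefficients of the factors up to
  \<open>n\<close>.\<close>

lemma tendsto_fps_mult:
  fixes f g :: "'b \<Rightarrow> 'a::comm_ring_1 fps"
  assumes "(f \<longlongrightarrow> F) A" "(g \<longlongrightarrow> G) A"
  shows "((\<lambda>x. f x * g x) \<longlongrightarrow> F * G) A"
proof (rule tendsto_fpsI)
  fix n
  have "\<forall>\<^sub>F x in A. \<forall>i\<in>{0..n}. fps_nth (f x) i = fps_nth F i"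
    by (rule eventually_ball_finite) (use assms in \<open>auto simp: tendsto_fps_iff\<close>)
  moreover have "\<forall>\<^sub>F x in A. \<forall>i\<in>{0..n}. fps_nth (g x) i = fps_nth G i"
    by (rule eventually_ball_finite) (use assms in \<open>auto simp: tendsto_fps_iff\<close>)
  ultimately show "\<forall>\<^sub>F x in A. fps_nth (f x * g x) n = fps_nth (F * G) n"
    by eventually_elim (auto simp: fps_mult_nth intro!: sum.cong)
qed

lemma tendsto_fps_add:
  fixes f g :: "'b \<Rightarrow> 'a::ab_group_add fps"
  assumes "(f \<longlongrightarrow> F) A" "(g \<longlongrightarrow> G) A"
  shows "((\<lambda>x. f x + g x) \<longlongrightarrow> F + G) A"
proof (rule tendsto_fpsI)
  fix n
  from assms have "\<forall>\<^sub>F x in A. fps_nth (f x) n = fps_nth F n"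
    and "\<forall>\<^sub>F x in A. fps_nth (g x) n = fps_nth G n"
    by (auto simp: tendsto_fps_iff)
  thus "\<forall>\<^sub>F x in A. fps_nth (f x + g x) n = fps_nth (F + G) n"
    by eventually_elim simp
qed

lemma tendsto_fps_diff:
  fixes f g :: "'b \<Rightarrow> 'a::ab_group_add fps"
  assumes "(f \<longlongrightarrow> F) A" "(g \<longlongrightarrow> G) A"
  shows "((\<lambda>x. f x - g x) \<longlongrightarrow> F - G) A"
proof (rule tendsto_fpsI)
  fix n
  from assms have "\<forall>\<^sub>F x in A. fps_nth (f x) n = fps_nth F n"
    and "\<forall>\<^sub>F x in A. fps_nth (g x) n = fps_nth G n"
    by (auto simp: tendsto_fps_iff)
  thus "\<forall>\<^sub>F x in A. fps_nth (f x - g x) n = fps_nth (F - G) n"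
    by eventually_elim simp
qed

lemma tendsto_fps_power:
  fixes f :: "'b \<Rightarrow> 'a::comm_ring_1 fps"
  assumes "(f \<longlongrightarrow> F) A"
  shows "((\<lambda>x. f x ^ n) \<longlongrightarrow> F ^ n) A"
  by (induction n) (auto intro: tendsto_fps_mult assms)

lemma tendsto_fps_compose_X_power:
  fixes f :: "'b \<Rightarrow> 'a::field fps"
  assumes "(f \<longlongrightarrow> F) A" "m > 0"
  shows "((\<lambda>x. f x oo fps_X ^ m) \<longlongrightarrow> (F oo fps_X ^ m)) A"
proof (rule tendsto_fpsI)
  fix n
  from assms have "\<forall>\<^sub>F x in A. fps_nth (f x) (n div m) = fps_nth F (n div m)"
    by (auto simp: tendsto_fps_iff)
  thus "\<forall>\<^sub>F x in A. fps_nth (f x oo fps_X ^ m) n = fps_nth (F oo fps_X ^ m) n"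
    by eventually_elim (use assms(2) in \<open>auto simp: fps_nth_compose_X_power\<close>)
qed

lemma LIMSEQ_fps_mult_index:
  fixes f :: "nat \<Rightarrow> 'a::group_add fps"
  assumes "f \<longlonglongrightarrow> F" "d > 0"
  shows "(\<lambda>n. f (d * n + r)) \<longlonglongrightarrow> F"
proof -
  have "strict_mono (\<lambda>n. d * n + r)"
    using assms(2) by (auto simp: strict_mono_def)
  from LIMSEQ_subseq_LIMSEQ[OF assms(1) this] show ?thesis by (simp add: o_def)
qed

text \<open>The q-Pochhammer product \<open>(-c q^a; q^m)_n\<close>. With the plus sign,
  \<open>c = -1\<close> gives Euler's products and \<open>c = 1\<close> products of factors
  \<open>1 + q^k\<close>.\<close>

definition qpoch :: "'a::field \<Rightarrow> nat \<Rightarrow> nat \<Rightarrow> nat \<Rightarrow> 'a fps" where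
  "qpoch c a m n = (\<Prod>k<n. 1 + fps_const c * fps_X ^ (m * k + a))"

text \<open>For \<open>m > 0\<close> the factor with index \<open>k\<close> has exponent at least
  \<open>k\<close>, so coefficient \<open>d\<close> is final after \<open>d + 1\<close>
  factors.\<close>

definition qpoch_inf :: "'a::field \<Rightarrow> nat \<Rightarrow> nat \<Rightarrow> 'a fps" where
  "qpoch_inf c a m = Abs_fps (\<lambda>d. fps_nth (qpoch c a m (Suc d)) d)"

lemma qpoch_0 [simp]: "qpoch c a m 0 = 1"
  by (simp add: qpoch_def)

lemma qpoch_Suc: "qpoch c a m (Suc n) = qpoch c a m n * (1 + fps_const c * fps_X ^ (m * n + a))"
  by (simp add: qpoch_def)

lemma fps_nth_qpoch_eq:
  assumes "m > 0" "d < n"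
  shows "fps_nth (qpoch c a m n) d = fps_nth (qpoch c a m (Suc d)) d"
  using assms(2)
proof (induction n)
  case (Suc n)
  show ?case
  proof (cases "d = n")
    case False
    with Suc have "d < n" by simp
    moreover have "n \<le> m * n" using assms(1) by simp
    ultimately have "d < m * n + a" by linarith
    hence "fps_nth (qpoch c a m n * (fps_const c * fps_X ^ (m * n + a))) d = 0"
      by (simp add: fps_X_power_mult_right_nth flip: mult.assoc)
    with Suc \<open>d < n\<close> show ?thesis by (simp add: qpoch_Suc distrib_left)
  qed simp
qed simp

lemma qpoch_LIMSEQ: "m > 0 \<Longrightarrow> qpoch c a m \<longlonglongrightarrow> qpoch_inf c a m"
proof (rule tendsto_fpsI)
  fix d assume "m > 0"
  show "\<forall>\<^sub>F n in sequentially. fps_nth (qpoch c a m n) d = fps_nth (qpoch_inf c a m) d"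
    using eventually_gt_at_top[of d]
    by eventually_elim (use fps_nth_qpoch_eq \<open>m > 0\<close> in \<open>auto simp: qpoch_inf_def\<close>)
qed

lemma qpoch_inf_nth_0: "a > 0 \<Longrightarrow> fps_nth (qpoch_inf c a m) 0 = 1"
  by (simp add: qpoch_inf_def qpoch_def)

text \<open>The factor with index 0 is the constant \<open>1 + c\<close>. For \<open>c = 1\<close>
  this is the source of the 2 in \<open>theta_psi\<close>.\<close>

lemma qpoch_inf_0:
  assumes "m > 0"
  shows "qpoch_inf c 0 m = fps_const (1 + c) * qpoch_inf c m m"
proof (rule LIMSEQ_unique)
  show "(\<lambda>n. qpoch c 0 m (1 * n + 1)) \<longlonglongrightarrow> qpoch_inf c 0 m"
    by (intro LIMSEQ_fps_mult_index qpoch_LIMSEQ assms) simp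
  have "qpoch c 0 m (Suc n) = fps_const (1 + c) * qpoch c m m n" for n
    unfolding qpoch_def prod.lessThan_Suc_shift by (simp add: add.commute fps_const_add [symmetric] del: fps_const_add)
  moreover have "(\<lambda>n. fps_const (1 + c) * qpoch c m m n) \<longlonglongrightarrow> fps_const (1 + c) * qpoch_inf c m m"
    by (intro tendsto_fps_mult tendsto_const qpoch_LIMSEQ assms)
  ultimately show "(\<lambda>n. qpoch c 0 m (1 * n + 1)) \<longlonglongrightarrow> fps_const (1 + c) * qpoch_inf c m m"
    by simp
qed

text \<open>The factors are sorted by their index modulo \<open>d\<close>.\<close>

lemma qpoch_inf_split:
  assumes "m > 0" "d > 0"
  shows "qpoch_inf c a m = (\<Prod>r<d. qpoch_inf c (a + r * m) (d * m))"
proof (rule LIMSEQ_unique)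
  show "(\<lambda>n. qpoch c a m (d * n + 0)) \<longlonglongrightarrow> qpoch_inf c a m"
    by (intro LIMSEQ_fps_mult_index qpoch_LIMSEQ assms)
  have *: "qpoch c a m (d * n) = (\<Prod>r<d. qpoch c (a + r * m) (d * m) n)" for n
  proof (induction n)
    case (Suc n)
    \<comment> \<open>A variable \<open>e\<close> in place of \<open>d\<close> lets the new factors
      be appended one at a time.\<close>
    have "qpoch c a m (d * n + e) = qpoch c a m (d * n) *
            (\<Prod>r<e. 1 + fps_const c * fps_X ^ (d * m * n + (a + r * m)))" for e
      by (induction e) (auto simp: qpoch_Suc algebra_simps)
    from this[of d] show ?case
      by (simp add: Suc.IH qpoch_Suc prod.distrib add.commute)
  qed simp
  have "(\<lambda>n. \<Prod>r<e. qpoch c (a + r * m) (d * m) n) \<longlonglongrightarrow> (\<Prod>r<e. qpoch_inf c (a + r * m) (d * m))" for e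
  proof (induction e)
    case (Suc e)
    have "d * m > 0" using assms by simp
    from tendsto_fps_mult[OF Suc qpoch_LIMSEQ[OF this]] show ?case by simp
  qed simp
  thus "(\<lambda>n. qpoch c a m (d * n + 0)) \<longlonglongrightarrow> (\<Prod>r<d. qpoch_inf c (a + r * m) (d * m))"
    by (simp add: *)
qed

text \<open>Factor by factor this is \<open>(1 + x) (1 - x) = 1 - x^2\<close>.\<close>

lemma qpoch_inf_plus_minus:
  assumes "m > 0"
  shows "qpoch_inf c a m * qpoch_inf (-c) a m = qpoch_inf (-(c^2)) (2 * a) (2 * m)"
proof (rule LIMSEQ_unique)
  show "(\<lambda>n. qpoch c a m n * qpoch (-c) a m n) \<longlonglongrightarrow> qpoch_inf c a m * qpoch_inf (-c) a m"
    by (intro tendsto_fps_mult qpoch_LIMSEQ assms)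
  have *: "(1 + fps_const c * fps_X ^ (m * k + a)) * (1 + fps_const (-c) * fps_X ^ (m * k + a))
        = 1 + fps_const (-(c^2)) * fps_X ^ (2 * m * k + 2 * a)" for k
  proof -
    have "fps_const (-c) = - fps_const c" and "fps_const (-(c^2)) = - (fps_const c ^ 2)"
      by (simp_all add: fps_const_power)
    moreover have "(fps_X :: 'a fps) ^ (2 * m * k + 2 * a) = (fps_X ^ (m * k + a)) ^ 2"
      by (simp add: algebra_simps flip: power_mult)
    ultimately show ?thesis by (simp only:) (simp add: algebra_simps power2_eq_square)
  qed
  have "qpoch c a m n * qpoch (-c) a m n = qpoch (-(c^2)) (2 * a) (2 * m) n" for n
    unfolding qpoch_def prod.distrib [symmetric] by (simp only: *)
  moreover have "qpoch (-(c^2)) (2 * a) (2 * m) \<longlonglongrightarrow> qpoch_inf (-(c^2)) (2 * a) (2 * m)"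
    by (intro qpoch_LIMSEQ) (use assms in auto)
  ultimately show "(\<lambda>n. qpoch c a m n * qpoch (-c) a m n) \<longlonglongrightarrow> qpoch_inf (-(c^2)) (2 * a) (2 * m)"
    by simp
qed

lemma qpoch_compose_X_power:
  "s > 0 \<Longrightarrow> qpoch c a m n oo fps_X ^ s = qpoch c (s * a) (s * m) n"
  by (simp add: qpoch_def fps_compose_prod_distrib fps_compose_add_distrib fps_compose_mult_distrib
      fps_compose_power [symmetric] power_mult [symmetric] algebra_simps)

lemma qpoch_inf_compose_X_power:
  assumes "s > 0" "m > 0"
  shows "qpoch_inf c a m oo fps_X ^ s = qpoch_inf c (s * a) (s * m)"
proof (rule LIMSEQ_unique)
  show "(\<lambda>n. qpoch c a m n oo fps_X ^ s) \<longlonglongrightarrow> (qpoch_inf c a m oo fps_X ^ s)"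
    by (intro tendsto_fps_compose_X_power qpoch_LIMSEQ assms)
  show "(\<lambda>n. qpoch c a m n oo fps_X ^ s) \<longlonglongrightarrow> qpoch_inf c (s * a) (s * m)"
    unfolding qpoch_compose_X_power[OF assms(1)] by (intro qpoch_LIMSEQ) (use assms in auto)
qed

lemma Eul_eq: "Eul = qpoch_inf (-1) 1 1"
proof (rule fps_ext)
  fix n
  \<comment> \<open>The truncation in \<open>qpoch_inf\<close> has one factor more than the one in
    \<open>Eul\<close>; its exponent \<open>n + 1\<close> exceeds the degree \<open>n\<close> in
    question.\<close>
  have "fps_nth (qpoch_inf (-1) 1 1) n = fps_nth (qpoch (-1::rat) 1 1 n * (1 - fps_X ^ Suc n)) n"
    by (simp add: qpoch_inf_def qpoch_Suc fps_const_neg [symmetric] del: power_Suc fps_const_neg)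
  also have "\<dots> = fps_nth (qpoch (-1::rat) 1 1 n) n"
    by (simp add: right_diff_distrib fps_X_power_mult_right_nth del: power_Suc)
  also have "qpoch (-1::rat) 1 1 n = (\<Prod>k\<in>{1..n}. (1 - fps_X ^ k))"
    unfolding qpoch_def by (rule prod.reindex_bij_witness[of _ "\<lambda>k. k - 1" Suc]) auto
  finally show "fps_nth Eul n = fps_nth (qpoch_inf (-1) 1 1) n"
    by (simp add: Eul_def)
qed

lemma Eq_eq: "m > 0 \<Longrightarrow> Eq m = qpoch_inf (-1) m m"
  by (simp add: Eq_def Eul_eq qpoch_inf_compose_X_power)

lemma Eq_compose: "m > 0 \<Longrightarrow> s > 0 \<Longrightarrow> Eq m oo fps_X ^ s = Eq (s * m)"
  by (simp add: Eq_eq qpoch_inf_compose_X_power)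

lemma Eq_nth_0: "m > 0 \<Longrightarrow> fps_nth (Eq m) 0 = 1"
  by (simp add: Eq_eq qpoch_inf_nth_0)

lemma Eq_nonzero: "m > 0 \<Longrightarrow> Eq m \<noteq> 0"
  using Eq_nth_0[of m] by auto

subsection \<open>The Jacobi triple product\<close>

text \<open>
  \<open>central_qbinom m n j\<close> is the Gaussian binomial coefficient of \<open>2 n\<close> over \<open>n + j\<close> in base \<open>q\<^sup>m\<close>;
  it is zero for \<open>\<bar>j\<bar> > n\<close>. The recursion comes from multiplying the finite triple product by its next two factors.
\<close>
fun central_qbinom :: "nat \<Rightarrow> nat \<Rightarrow> int \<Rightarrow> 'a::field fps" where
  "central_qbinom m 0 j = (if j = 0 then 1 else 0)"
| "central_qbinom m (Suc n) j =
     (1 + fps_X ^ (m * (2 * n + 1))) * central_qbinom m n j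
     + fps_X ^ (m * nat (int n + 1 - j)) * central_qbinom m n (j - 1)
     + fps_X ^ (m * nat (int n + 1 + j)) * central_qbinom m n (j + 1)"

lemma central_qbinom_eq_0: "\<bar>j\<bar> > int n \<Longrightarrow> central_qbinom m n j = 0"
  by (induction n arbitrary: j) auto

text \<open>The closed form of the Gaussian binomial, cleared of denominators. In the induction each
  of the three terms of the recursion becomes a multiple of \<open>P (2 * n)\<close>.\<close>

lemma central_qbinom_mult_qpoch:
  assumes "\<bar>j\<bar> \<le> int n"
  shows "central_qbinom m n j * (qpoch (-1) m m (nat (int n - j)) * qpoch (-1) m m (nat (int n + j)))
         = qpoch (-1) m m (2 * n)"
  using assms
proof (induction n arbitrary: j)
  case 0
  thus ?case by simp
next
  case (Suc n)
  define P where "P = qpoch (-1 :: 'a) m m"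
  define Q where "Q = (fps_X :: 'a fps) ^ m"
  define r s where "r = nat (int n + 1 - j)" and "s = nat (int n + 1 + j)"
  have P_Suc: "P (Suc k) = P k * (1 - Q ^ Suc k)" for k
    by (simp add: P_def Q_def qpoch_Suc fps_const_neg [symmetric] power_mult [symmetric]
          power_add [symmetric] add.commute del: fps_const_neg)
  have Q_pow: "fps_X ^ (m * k) = Q ^ k" for k
    by (simp add: Q_def power_mult)
  have rs: "r + s = 2 * n + 2" "int r = int n + 1 - j" "int s = int n + 1 + j"
    using Suc.prems by (auto simp: r_def s_def)
  have IH: "central_qbinom m n i * (P (nat (int n - i)) * P (nat (int n + i))) = P (2 * n)"
    if "\<bar>i\<bar> \<le> int n" for i
    using Suc.IH[OF that] by (simp add: P_def)
  have t1: "central_qbinom m n j * (P r * P s) = P (2 * n) * (1 - Q ^ r) * (1 - Q ^ s)"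
  proof (cases "\<bar>j\<bar> \<le> int n")
    case True
    hence "r = Suc (r - 1)" "s = Suc (s - 1)" using rs by auto
    then obtain r' s' where r's': "r = Suc r'" "s = Suc s'" by blast
    hence "nat (int n - j) = r'" "nat (int n + j) = s'" using rs by auto
    with IH[OF True] show ?thesis
      by (simp only: r's' P_Suc flip: IH[OF True]) (simp only: ac_simps)
  next
    case False
    with Suc.prems have "r = 0 \<or> s = 0" using rs by auto
    with False show ?thesis by (auto simp: central_qbinom_eq_0)
  qed
  \<comment> \<open>The extra \<open>Q\<close> turns \<open>1 - Q ^ (s - 1)\<close> into
    \<open>Q - Q ^ s\<close>, so that the formula stays valid in the boundary case
    \<open>s = 1\<close>, where both sides vanish.\<close>
  have t2: "Q * (central_qbinom m n (j - 1) * (P r * P s)) = P (2 * n) * (Q - Q ^ s) * (1 - Q ^ s)"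
  proof (cases "\<bar>j - 1\<bar> \<le> int n")
    case True
    hence "s = Suc (Suc (s - 2))" using rs by auto
    then obtain s' where s': "s = Suc (Suc s')" by blast
    hence "nat (int n - (j - 1)) = r" "nat (int n + (j - 1)) = s'" using rs by auto
    with IH[OF True] have "P (2 * n) = central_qbinom m n (j - 1) * (P r * P s')"
      by simp
    moreover have "Q * (B * (x * (y * (1 - z) * (1 - Q * z)))) = B * (x * y) * (Q - Q * z) * (1 - Q * z)"
      for B x y z :: "'a fps"
      by algebra
    ultimately show ?thesis by (simp only: s' P_Suc power_Suc)
  next
    case False
    with Suc.prems have "s = 0 \<or> s = 1" using rs by auto
    with False show ?thesis by (auto simp: central_qbinom_eq_0)
  qed
  have t3: "Q * (central_qbinom m n (j + 1) * (P r * P s)) = P (2 * n) * (Q - Q ^ r) * (1 - Q ^ r)"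
  proof (cases "\<bar>j + 1\<bar> \<le> int n")
    case True
    hence "r = Suc (Suc (r - 2))" using rs by auto
    then obtain r' where r': "r = Suc (Suc r')" by blast
    hence "nat (int n - (j + 1)) = r'" "nat (int n + (j + 1)) = s" using rs by auto
    with IH[OF True] have "P (2 * n) = central_qbinom m n (j + 1) * (P r' * P s)"
      by simp
    moreover have "Q * (B * (x * (y * (1 - z) * (1 - Q * z)))) = B * (x * y) * (Q - Q * z) * (1 - Q * z)"
      for B x y z :: "'a fps"
      by algebra
    ultimately show ?thesis by (simp only: r' P_Suc power_Suc mult.commute[of _ "P s"])
  next
    case False
    with Suc.prems have "r = 0 \<or> r = 1" using rs by auto
    with False show ?thesis by (auto simp: central_qbinom_eq_0)
  qed
  have uv: "Q ^ r * Q ^ s = Q * (Q ^ (2 * n + 1))" "Q * Q ^ (2 * n + 1) = Q ^ Suc (Suc (2 * n))"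
    by (simp_all add: rs flip: power_add)
  have "Q * (central_qbinom m (Suc n) j * (P r * P s)) =
          (1 + Q ^ (2 * n + 1)) * Q * (central_qbinom m n j * (P r * P s))
          + Q ^ r * (Q * (central_qbinom m n (j - 1) * (P r * P s)))
          + Q ^ s * (Q * (central_qbinom m n (j + 1) * (P r * P s)))"
    by (simp only: central_qbinom.simps Q_pow r_def s_def) (simp only: algebra_simps)
  also have "\<dots> = P (2 * n) * ((1 + Q ^ (2 * n + 1)) * Q * ((1 - Q ^ r) * (1 - Q ^ s))
          + Q ^ r * ((Q - Q ^ s) * (1 - Q ^ s)) + Q ^ s * ((Q - Q ^ r) * (1 - Q ^ r)))"
    by (simp only: t1 t2 t3) (simp only: algebra_simps)
  also have "(1 + Q ^ (2 * n + 1)) * Q * ((1 - Q ^ r) * (1 - Q ^ s))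
          + Q ^ r * ((Q - Q ^ s) * (1 - Q ^ s)) + Q ^ s * ((Q - Q ^ r) * (1 - Q ^ r))
        = Q * ((1 - Q ^ (2 * n + 1)) * (1 - Q * Q ^ (2 * n + 1)))"
  proof -
    \<comment> \<open>With \<open>u = Q ^ r\<close>, \<open>v = Q ^ s\<close> and
      \<open>w = Q ^ (2 * n + 1)\<close>, only \<open>u * v = Q * w\<close> is needed, that is,
      \<open>r + s = 2 * n + 2\<close>.\<close>
    have "(1 + w) * Q * ((1 - u) * (1 - v)) + u * ((Q - v) * (1 - v)) + v * ((Q - u) * (1 - u))
          = Q * ((1 - w) * (1 - Q * w))" if "u * v = Q * w" for u v w :: "'a fps"
      using that by algebra
    from this[OF uv(1)] show ?thesis .
  qed
  also have "P (2 * n) * (Q * ((1 - Q ^ (2 * n + 1)) * (1 - Q * Q ^ (2 * n + 1)))) = Q * P (2 * Suc n)"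
    by (simp only: uv(2)) (simp add: P_Suc)
  finally have "central_qbinom m (Suc n) j * (P r * P s) = P (2 * Suc n)"
    by (simp add: Q_def)
  thus ?case by (simp add: P_def r_def s_def add.commute)
qed

text \<open>The exponent of \<open>q\<close> in the general term of Ramanujan's theta series
  \<open>f(q^a, q^(m - a))\<close>.\<close>

definition theta_exp :: "nat \<Rightarrow> nat \<Rightarrow> int \<Rightarrow> int" where
  "theta_exp a m j = int m * (j * (j - 1) div 2) + int a * j"

definition theta_term :: "'a::field \<Rightarrow> nat \<Rightarrow> nat \<Rightarrow> int \<Rightarrow> 'a fps" where
  "theta_term c a m j = fps_const (c powi j) * fps_X ^ nat (theta_exp a m j)"

lemma theta_exp_pred: "theta_exp a m j = theta_exp a m (j - 1) + int m * (j - 1) + int a"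
proof -
  have "j * (j - 1) = (j - 1) * (j - 2) + (j - 1) * 2"
    by (simp add: algebra_simps)
  hence *: "j * (j - 1) div 2 = (j - 1) * (j - 1 - 1) div 2 + (j - 1)"
    by simp
  show ?thesis unfolding theta_exp_def * by (simp only: distrib_left right_diff_distrib)
qed

text \<open>Nonnegativity makes the conversion by \<open>nat\<close> in \<open>theta_term\<close>
  harmless; linear growth in the absolute value of \<open>j\<close> leaves finitely many terms for
  each coefficient.\<close>

lemma theta_exp_ge:
  assumes "m > 0" "a \<le> m"
  shows "\<bar>j\<bar> \<le> theta_exp a m j + 1" "0 \<le> theta_exp a m j"
proof -
  define T where "T = j * (j - 1) div 2"
  have T: "2 * T = j * (j - 1)"
    unfolding T_def by simp
  have "\<bar>j\<bar> \<le> theta_exp a m j + 1 \<and> 0 \<le> theta_exp a m j"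
  proof (cases "j \<ge> 1")
    case True
    have "0 \<le> (j - 1) * (j - 2)"
      using True by (cases "j = 1") auto
    hence "T \<ge> j - 1" using T by (simp add: algebra_simps)
    moreover from this have "int m * T \<ge> 1 * T"
      using assms True by (intro mult_right_mono) auto
    moreover have "int a * j \<ge> 0" using True by simp
    ultimately show ?thesis using True
      unfolding theta_exp_def T_def[symmetric] by linarith
  next
    case False
    \<comment> \<open>For \<open>j \<le> 0\<close> the hypothesis \<open>a \<le> m\<close> bounds
      the exponent below by \<open>m (T + j)\<close>, where
      \<open>T + j = j (j + 1) / 2\<close>.\<close>
    have "0 \<le> (j + 1) * (j + 2)" "0 \<le> j * (j + 1)"
      using False by (cases "j = 0"; cases "j = -1"; auto simp: zero_le_mult_iff)+
    hence "T + j \<ge> - j - 1" "T + j \<ge> 0" using T by (simp_all add: algebra_simps)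
    moreover from this have "int m * (T + j) \<ge> 1 * (T + j)"
      using assms by (intro mult_right_mono) auto
    moreover have "int a * j \<ge> int m * j"
      using False assms by (intro mult_right_mono_neg) auto
    ultimately show ?thesis using False
      unfolding theta_exp_def T_def[symmetric] by (simp add: distrib_left)
  qed
  thus "\<bar>j\<bar> \<le> theta_exp a m j + 1" "0 \<le> theta_exp a m j" by auto
qed

text \<open>Matches the term with \<open>j - 1\<close> in the recursion of
  \<open>central_qbinom\<close>: its power of \<open>q\<close> is traded for a shift of the theta
  term and a factor independent of \<open>j\<close>.\<close>

lemma theta_term_pred:
  assumes "c ^ 2 = 1" "m > 0" "a \<le> m" "j \<le> int n + 1"
  shows "fps_const c * fps_X ^ (m * n + a) * theta_term c a m (j - 1)
         = fps_X ^ (m * nat (int n + 1 - j)) * theta_term c a m j"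
proof -
  have "c \<noteq> 0" using assms(1) by auto
  hence c: "c powi j = c * c powi (j - 1)"
    by (simp add: power_int_diff)
  have "int (m * n + a + nat (theta_exp a m (j - 1))) = int (m * nat (int n + 1 - j) + nat (theta_exp a m j))"
    using theta_exp_ge[OF assms(2,3)] theta_exp_pred[of a m j] assms(4) by (simp add: algebra_simps)
  hence e: "m * n + a + nat (theta_exp a m (j - 1)) = m * nat (int n + 1 - j) + nat (theta_exp a m j)"
    by (simp only: of_nat_eq_iff)
  have "fps_const c * fps_X ^ (m * n + a) * theta_term c a m (j - 1) =
      fps_const (c * c powi (j - 1)) * fps_X ^ (m * n + a + nat (theta_exp a m (j - 1)))"
    by (simp add: theta_term_def power_add fps_const_mult [symmetric] ac_simps del: fps_const_mult)
  also have "\<dots> = fps_const (c powi j) * (fps_X ^ (m * nat (int n + 1 - j)) * fps_X ^ nat (theta_exp a m j))"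
    unfolding e c power_add ..
  finally show ?thesis by (simp add: theta_term_def ac_simps)
qed

text \<open>The mirror image of \<open>theta_term_pred\<close> for the term with
  \<open>j + 1\<close>; here \<open>c^2 = 1\<close> is what moves \<open>c\<close> to the other
  side.\<close>

lemma theta_term_succ:
  assumes "c ^ 2 = 1" "m > 0" "a + b = m" "j \<ge> - int n - 1"
  shows "fps_const c * fps_X ^ (m * n + b) * theta_term c a m (j + 1)
         = fps_X ^ (m * nat (int n + 1 + j)) * theta_term c a m j"
proof -
  have "c \<noteq> 0" using assms(1) by auto
  hence "c * c powi (j + 1) = c ^ 2 * c powi j"
    by (simp add: power_int_add power2_eq_square)
  hence c: "c * c powi (j + 1) = c powi j" using assms(1) by simp
  have "a \<le> m" "int m = int a + int b" using assms(3) by auto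
  have "int (m * n + b + nat (theta_exp a m (j + 1))) = int (m * nat (int n + 1 + j) + nat (theta_exp a m j))"
    using theta_exp_ge(2)[OF assms(2) \<open>a \<le> m\<close>, of "j + 1"] theta_exp_ge(2)[OF assms(2) \<open>a \<le> m\<close>, of j]
      theta_exp_pred[of a m "j + 1"] assms(4)
    by (simp add: \<open>int m = _\<close> distrib_left distrib_right)
  hence e: "m * n + b + nat (theta_exp a m (j + 1)) = m * nat (int n + 1 + j) + nat (theta_exp a m j)"
    by (simp only: of_nat_eq_iff)
  have "fps_const c * fps_X ^ (m * n + b) * theta_term c a m (j + 1) =
      fps_const (c * c powi (j + 1)) * fps_X ^ (m * n + b + nat (theta_exp a m (j + 1)))"
    by (simp add: theta_term_def power_add fps_const_mult [symmetric] ac_simps del: fps_const_mult)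
  also have "\<dots> = fps_const (c powi j) * (fps_X ^ (m * nat (int n + 1 + j)) * fps_X ^ nat (theta_exp a m j))"
    unfolding e c power_add ..
  finally show ?thesis by (simp add: theta_term_def ac_simps)
qed

text \<open>The next two factors multiply out to \<open>1 + q^(m (2 n + 1))\<close>, which keeps the
  summation index, and two terms with \<open>c\<close>, which shift it by one in either direction.
  This is the recursion of \<open>central_qbinom\<close>.\<close>

lemma finite_jacobi_triple_product:
  assumes "c ^ 2 = 1" "m > 0" "a + b = m"
  shows "qpoch c a m n * qpoch c b m n =
         (\<Sum>j\<in>{-int n..int n}. central_qbinom m n j * theta_term c a m j)"
proof (induction n)
  case 0
  show ?case by (simp add: theta_term_def theta_exp_def)
next
  case (Suc n)
  let ?t = "theta_term c a m" and ?B = "central_qbinom m n :: int \<Rightarrow> 'a fps"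
  let ?J = "{-int (Suc n)..int (Suc n)}"
  define F where "F = (\<Sum>j\<in>{-int n..int n}. ?B j * ?t j)"
  \<comment> \<open>The coefficients vanish outside the original range, so the ranges arising from
    index shifts all give the same sum.\<close>
  have F: "F = (\<Sum>j\<in>S. ?B j * ?t j)" if "{-int n..int n} \<subseteq> S" "finite S" for S
    unfolding F_def by (rule sum.mono_neutral_left) (use that in \<open>auto simp: central_qbinom_eq_0\<close>)
  have "a \<le> m" using assms by simp
  have 1: "(\<Sum>j\<in>?J. fps_X ^ (m * nat (int n + 1 - j)) * ?B (j - 1) * ?t j)
             = fps_const c * fps_X ^ (m * n + a) * F"
  proof -
    have "(\<Sum>j\<in>?J. fps_X ^ (m * nat (int n + 1 - j)) * ?B (j - 1) * ?t j)
        = (\<Sum>j\<in>?J. fps_const c * fps_X ^ (m * n + a) * (?B (j - 1) * ?t (j - 1)))"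
    proof (rule sum.cong)
      fix j assume "j \<in> ?J"
      hence le: "j \<le> int n + 1" by simp
      have "fps_X ^ (m * nat (int n + 1 - j)) * ?B (j - 1) * ?t j
            = ?B (j - 1) * (fps_X ^ (m * nat (int n + 1 - j)) * ?t j)"
        by (simp only: ac_simps)
      also have "fps_X ^ (m * nat (int n + 1 - j)) * ?t j = fps_const c * fps_X ^ (m * n + a) * ?t (j - 1)"
        by (rule theta_term_pred[OF assms(1,2) \<open>a \<le> m\<close> le, symmetric])
      also have "?B (j - 1) * (fps_const c * fps_X ^ (m * n + a) * ?t (j - 1))
            = fps_const c * fps_X ^ (m * n + a) * (?B (j - 1) * ?t (j - 1))"
        by (simp only: ac_simps)
      finally show "fps_X ^ (m * nat (int n + 1 - j)) * ?B (j - 1) * ?t j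
            = fps_const c * fps_X ^ (m * n + a) * (?B (j - 1) * ?t (j - 1))" .
    qed simp
    also have "\<dots> = fps_const c * fps_X ^ (m * n + a) * (\<Sum>j\<in>?J. ?B (j - 1) * ?t (j - 1))"
      by (simp add: sum_distrib_left)
    also have "(\<Sum>j\<in>?J. ?B (j - 1) * ?t (j - 1)) = (\<Sum>j\<in>{-int n-2..int n}. ?B j * ?t j)"
      by (rule sum.reindex_bij_witness[of _ "\<lambda>j. j + 1" "\<lambda>j. j - 1"]) auto
    also have "\<dots> = F" by (rule F [symmetric]) auto
    finally show ?thesis .
  qed
  have 2: "(\<Sum>j\<in>?J. fps_X ^ (m * nat (int n + 1 + j)) * ?B (j + 1) * ?t j)
             = fps_const c * fps_X ^ (m * n + b) * F"
  proof -
    have "(\<Sum>j\<in>?J. fps_X ^ (m * nat (int n + 1 + j)) * ?B (j + 1) * ?t j)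
        = (\<Sum>j\<in>?J. fps_const c * fps_X ^ (m * n + b) * (?B (j + 1) * ?t (j + 1)))"
    proof (rule sum.cong)
      fix j assume "j \<in> ?J"
      hence le: "j \<ge> - int n - 1" by simp
      have "fps_X ^ (m * nat (int n + 1 + j)) * ?B (j + 1) * ?t j
            = ?B (j + 1) * (fps_X ^ (m * nat (int n + 1 + j)) * ?t j)"
        by (simp only: ac_simps)
      also have "fps_X ^ (m * nat (int n + 1 + j)) * ?t j = fps_const c * fps_X ^ (m * n + b) * ?t (j + 1)"
        by (rule theta_term_succ[OF assms le, symmetric])
      also have "?B (j + 1) * (fps_const c * fps_X ^ (m * n + b) * ?t (j + 1))
            = fps_const c * fps_X ^ (m * n + b) * (?B (j + 1) * ?t (j + 1))"
        by (simp only: ac_simps)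
      finally show "fps_X ^ (m * nat (int n + 1 + j)) * ?B (j + 1) * ?t j
            = fps_const c * fps_X ^ (m * n + b) * (?B (j + 1) * ?t (j + 1))" .
    qed simp
    also have "\<dots> = fps_const c * fps_X ^ (m * n + b) * (\<Sum>j\<in>?J. ?B (j + 1) * ?t (j + 1))"
      by (simp add: sum_distrib_left)
    also have "(\<Sum>j\<in>?J. ?B (j + 1) * ?t (j + 1)) = (\<Sum>j\<in>{-int n..int n+2}. ?B j * ?t j)"
      by (rule sum.reindex_bij_witness[of _ "\<lambda>j. j - 1" "\<lambda>j. j + 1"]) auto
    also have "\<dots> = F" by (rule F [symmetric]) auto
    finally show ?thesis .
  qed
  have "(\<Sum>j\<in>?J. central_qbinom m (Suc n) j * ?t j) =
     (1 + fps_X ^ (m * (2 * n + 1))) * (\<Sum>j\<in>?J. ?B j * ?t j)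
     + (\<Sum>j\<in>?J. fps_X ^ (m * nat (int n + 1 - j)) * ?B (j - 1) * ?t j)
     + (\<Sum>j\<in>?J. fps_X ^ (m * nat (int n + 1 + j)) * ?B (j + 1) * ?t j)"
    by (simp only: central_qbinom.simps distrib_right sum.distrib sum_distrib_left mult.assoc)
  also have "(\<Sum>j\<in>?J. ?B j * ?t j) = F"
    by (rule F [symmetric]) auto
  finally have 3: "(\<Sum>j\<in>?J. central_qbinom m (Suc n) j * ?t j) = F *
      (1 + fps_X ^ (m * (2 * n + 1)) + fps_const c * fps_X ^ (m * n + a) + fps_const c * fps_X ^ (m * n + b))"
    unfolding 1 2 by (simp only: distrib_left mult.commute mult_1_right)
  have cX: "fps_const c * fps_X ^ (m * n + a) * (fps_const c * fps_X ^ (m * n + b)) = fps_X ^ (m * (2 * n + 1))"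
  proof -
    have "fps_const c * fps_X ^ (m * n + a) * (fps_const c * fps_X ^ (m * n + b))
        = (fps_const c * fps_const c) * (fps_X ^ (m * n + a) * fps_X ^ (m * n + b))"
      by (simp only: ac_simps)
    also have "fps_const c * fps_const c = 1"
      using assms(1) by (simp add: power2_eq_square)
    also have "fps_X ^ (m * n + a) * (fps_X :: 'a fps) ^ (m * n + b) = fps_X ^ (m * (2 * n + 1))"
      unfolding assms(3)[symmetric] by (simp add: algebra_simps flip: power_add)
    finally show ?thesis by simp
  qed
  have 4: "(1 + fps_const c * fps_X ^ (m * n + a)) * (1 + fps_const c * fps_X ^ (m * n + b))
    = 1 + fps_X ^ (m * (2 * n + 1)) + fps_const c * fps_X ^ (m * n + a) + fps_const c * fps_X ^ (m * n + b)"
    by (simp only: distrib_left distrib_right mult_1_left mult_1_right cX) (simp only: add_ac)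
  have "qpoch c a m (Suc n) * qpoch c b m (Suc n) = (qpoch c a m n * qpoch c b m n) *
     ((1 + fps_const c * fps_X ^ (m * n + a)) * (1 + fps_const c * fps_X ^ (m * n + b)))"
    by (simp only: qpoch_Suc ac_simps)
  thus ?case unfolding 3 4 Suc.IH F_def[symmetric] .
qed

text \<open>With \<open>Q = q^m\<close>, the closed form
  \<open>(Q)_(2n) / ((Q)_(n-j) (Q)_(n+j))\<close> tends to
  \<open>1 / (Q)_\<infinity>\<close>.\<close>

lemma tendsto_central_qbinom:
  assumes "m > 0"
  shows "(\<lambda>n. qpoch_inf (-1) m m * central_qbinom m n j) \<longlonglongrightarrow> (1 :: 'a::field fps)"
proof -
  define P :: "nat \<Rightarrow> 'a fps" where "P = qpoch (-1) m m"
  define L :: "'a fps" where "L = qpoch_inf (-1) m m"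
  have P: "P \<longlonglongrightarrow> L" unfolding P_def L_def by (rule qpoch_LIMSEQ) fact
  have L0: "fps_nth L 0 = 1" unfolding L_def by (rule qpoch_inf_nth_0) fact
  have P0: "fps_nth (P n) 0 \<noteq> 0" for n
    using assms by (induction n) (auto simp: P_def qpoch_Suc)
  have sub: "(\<lambda>n. P (nat (int n + i))) \<longlonglongrightarrow> L" for i
  proof (rule filterlim_compose[OF P])
    show "filterlim (\<lambda>n. nat (int n + i)) sequentially sequentially"
      unfolding filterlim_at_top
    proof
      fix Z
      show "\<forall>\<^sub>F n in sequentially. Z \<le> nat (int n + i)"
        using eventually_ge_at_top[of "Z + nat \<bar>i\<bar>"] by eventually_elim auto
    qed
  qed
  have "(\<lambda>n. P (2 * n + 0)) \<longlonglongrightarrow> L" by (intro LIMSEQ_fps_mult_index P) simp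
  hence "(\<lambda>n. L * (P (2 * n + 0) * inverse (P (nat (int n + (-j))) * P (nat (int n + j)))))
     \<longlonglongrightarrow> L * (L * inverse (L * L))"
    by (intro tendsto_fps_mult tendsto_const tendsto_inverse_fps sub) (simp_all add: L0)
  also have "L * (L * inverse (L * L)) = (L * L) * inverse (L * L)" by (simp add: mult.assoc)
  also have "\<dots> = 1" by (rule inverse_mult_eq_1') (simp add: L0)
  finally have lim: "(\<lambda>n. L * (P (2 * n + 0) * inverse (P (nat (int n + (-j))) * P (nat (int n + j)))))
     \<longlonglongrightarrow> 1" .
  have ev: "\<forall>\<^sub>F n in sequentially. L * (P (2 * n + 0) * inverse (P (nat (int n + (-j))) * P (nat (int n + j))))
          = L * central_qbinom m n j"
    using eventually_ge_at_top[of "nat \<bar>j\<bar>"]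
  proof eventually_elim
    case (elim n)
    let ?D = "P (nat (int n + (-j))) * P (nat (int n + j))"
    have "central_qbinom m n j * ?D = P (2 * n)"
      using central_qbinom_mult_qpoch[where 'a = 'a, of j n m] elim by (auto simp: P_def)
    moreover have "?D * inverse ?D = 1"
      by (rule inverse_mult_eq_1') (simp add: P0)
    ultimately have "central_qbinom m n j * 1 = P (2 * n) * inverse ?D"
      by (simp only: mult.assoc flip: \<open>?D * inverse ?D = 1\<close> \<open>_ = P (2 * n)\<close>)
    thus ?case by simp
  qed
  show ?thesis
    using tendsto_cong[THEN iffD1, OF ev lim] by (simp add: L_def)
qed

text \<open>The limit of the finite form. Limit and sum may be exchanged because only finitely many
  indices \<open>j\<close> contribute to a given coefficient.\<close>

lemma jacobi_triple_product:
  fixes c :: "'a::field"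
  assumes "c ^ 2 = 1" "m > 0" "a + b = m"
  shows "(\<lambda>n. \<Sum>j\<in>{-int n..int n}. theta_term c a m j) \<longlonglongrightarrow>
           qpoch_inf (-1) m m * (qpoch_inf c a m * qpoch_inf c b m)"
proof -
  let ?L = "qpoch_inf (-1) m m :: 'a fps"
  \<comment> \<open>The error made when the normalised binomial is replaced by its limit 1.\<close>
  define R where "R = (\<lambda>n j. ?L * central_qbinom m n j - 1)"
  have R: "(\<lambda>n. R n j) \<longlonglongrightarrow> 0" for j
    using tendsto_fps_diff[OF tendsto_central_qbinom[OF assms(2), of j] tendsto_const[of 1]]
    by (simp add: R_def)
  have "a \<le> m" using assms by simp
  have "(\<lambda>n. \<Sum>j\<in>{-int n..int n}. R n j * theta_term c a m j) \<longlonglongrightarrow> 0"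
  proof (rule tendsto_fpsI)
    fix d
    \<comment> \<open>By \<open>theta_exp_ge\<close>, every other \<open>j\<close> has a theta term
      of exponent greater than \<open>d\<close>.\<close>
    have "\<forall>\<^sub>F n in sequentially. \<forall>j\<in>{-int d-1..int d+1}. fps_nth (R n j * theta_term c a m j) d = 0"
    proof (rule eventually_ball_finite, simp, rule ballI)
      fix j
      have "(\<lambda>n. R n j * theta_term c a m j) \<longlonglongrightarrow> 0 * theta_term c a m j"
        by (intro tendsto_fps_mult R tendsto_const)
      thus "\<forall>\<^sub>F n in sequentially. fps_nth (R n j * theta_term c a m j) d = 0"
        by (simp add: tendsto_fps_iff)
    qed
    thus "\<forall>\<^sub>F n in sequentially. fps_nth (\<Sum>j\<in>{-int n..int n}. R n j * theta_term c a m j) d = fps_nth 0 d"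
    proof eventually_elim
      case (elim n)
      have "fps_nth (R n j * theta_term c a m j) d = 0" for j
      proof (cases "j \<in> {-int d-1..int d+1}")
        case False
        hence "d < nat (theta_exp a m j)"
          using theta_exp_ge(1)[OF assms(2) \<open>a \<le> m\<close>, of j] by auto
        thus ?thesis
          by (simp add: theta_term_def fps_X_power_mult_right_nth flip: mult.assoc)
      qed (use elim in auto)
      thus ?case by (simp add: fps_sum_nth)
    qed
  qed
  from tendsto_fps_diff[OF tendsto_fps_mult[OF tendsto_const[of ?L]
       tendsto_fps_mult[OF qpoch_LIMSEQ[OF assms(2), of c a] qpoch_LIMSEQ[OF assms(2), of c b]]] this]
  have "(\<lambda>n. ?L * (qpoch c a m n * qpoch c b m n) - (\<Sum>j\<in>{-int n..int n}. R n j * theta_term c a m j))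
      \<longlonglongrightarrow> ?L * (qpoch_inf c a m * qpoch_inf c b m)"
    by simp
  also have "(\<lambda>n. ?L * (qpoch c a m n * qpoch c b m n) - (\<Sum>j\<in>{-int n..int n}. R n j * theta_term c a m j))
     = (\<lambda>n. \<Sum>j\<in>{-int n..int n}. theta_term c a m j)"
    unfolding finite_jacobi_triple_product[OF assms] sum_distrib_left sum_subtractf[symmetric] R_def
    by (simp add: algebra_simps)
  finally show ?thesis .
qed

subsection \<open>Theta series as eta quotients and their trisections\<close>

definition theta :: "'a::field \<Rightarrow> nat \<Rightarrow> nat \<Rightarrow> 'a fps" where
  "theta c a m = qpoch_inf (-1) m m * (qpoch_inf c a m * qpoch_inf c (m - a) m)"

lemma theta_LIMSEQ:
  assumes "c ^ 2 = 1" "m > 0" "a \<le> m"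
  shows "(\<lambda>n. \<Sum>j\<in>{-int n..int n}. theta_term c a m j) \<longlonglongrightarrow> theta c a m"
  unfolding theta_def by (rule jacobi_triple_product) (use assms in auto)

lemma prod_lessThan_small:
  "(\<Prod>r<2::nat. f r) = f 0 * f 1"
  "(\<Prod>r<3::nat. f r) = f 0 * f 1 * f 2"
  "(\<Prod>r<6::nat. f r) = f 0 * f 1 * f 2 * f 3 * f 4 * (f 5 :: 'a::comm_monoid_mult)"
  by (simp_all add: eval_nat_numeral)

lemma theta_phi:
  assumes "s > 0"
  shows "theta (-1) s (2 * s) * Eq (2 * s) = Eq s ^ 2"
proof -
  have "Eq s = qpoch_inf (-1) s (2 * s) * qpoch_inf (-1) (2 * s) (2 * s)"
    using qpoch_inf_split[of s 2 "-1 :: rat" s] assms by (simp add: Eq_eq prod_lessThan_small flip: mult_2)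
  thus ?thesis using assms by (simp add: theta_def Eq_eq power2_eq_square)
qed

text \<open>The series with terms \<open>(-1)^j q^(s (3 j^2 - 2 j))\<close>. All Euler products
  involved are split into residue classes modulo \<open>6 s\<close>.\<close>

lemma theta_omega:
  assumes "s > 0"
  shows "theta (-1) s (6 * s) * (Eq (2 * s) * Eq (3 * s)) = Eq s * Eq (6 * s) ^ 2"
proof -
  define R where "R r = qpoch_inf (-1 :: rat) (r * s) (6 * s)" for r
  have "Eq s = R 1 * R 2 * R 3 * R 4 * R 5 * R 6"
    using qpoch_inf_split[of s 6 "-1 :: rat" s] assms by (simp add: Eq_eq R_def prod_lessThan_small flip: mult_2)
  moreover have "Eq (2 * s) = R 2 * R 4 * R 6"
    using qpoch_inf_split[of "2 * s" 3 "-1 :: rat" "2 * s"] assms by (simp add: Eq_eq R_def prod_lessThan_small flip: mult_2)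
  moreover have "Eq (3 * s) = R 3 * R 6"
    using qpoch_inf_split[of "3 * s" 2 "-1 :: rat" "3 * s"] assms by (simp add: Eq_eq R_def prod_lessThan_small flip: mult_2)
  moreover have "theta (-1) s (6 * s) = R 6 * (R 1 * R 5)" "Eq (6 * s) = R 6"
    using assms by (simp_all add: theta_def R_def Eq_eq)
  ultimately show ?thesis by (simp only: power2_eq_square ac_simps)
qed

text \<open>Splitting is modulo \<open>3 s\<close>; the factors with \<open>c = 1\<close> enter
  through \<open>(1 + x) (1 - x) = 1 - x^2\<close>, applied to \<open>Eq (2 * s)\<close>.\<close>

lemma theta_f:
  assumes "s > 0"
  shows "theta 1 s (3 * s) * (Eq s * Eq (6 * s)) = Eq (2 * s) * Eq (3 * s) ^ 2"
proof -
  define R where "R r = qpoch_inf (-1 :: rat) (r * s) (3 * s)" for r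
  define R' where "R' r = qpoch_inf (1 :: rat) (r * s) (3 * s)" for r
  have "Eq s = R 1 * R 2 * R 3"
    using qpoch_inf_split[of s 3 "-1 :: rat" s] assms by (simp add: Eq_eq R_def prod_lessThan_small flip: mult_2)
  moreover have "Eq (2 * s) = (R' 1 * R 1) * (R' 2 * R 2) * Eq (6 * s)"
    using qpoch_inf_split[of "2 * s" 3 "-1 :: rat" "2 * s"] assms
      qpoch_inf_plus_minus[of "3 * s" "1 :: rat" s] qpoch_inf_plus_minus[of "3 * s" "1 :: rat" "2 * s"]
    by (simp add: Eq_eq R_def R'_def prod_lessThan_small flip: mult_2)
  moreover have "theta 1 s (3 * s) = R 3 * (R' 1 * R' 2)" "Eq (3 * s) = R 3"
    using assms by (simp_all add: theta_def R_def R'_def Eq_eq)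
  ultimately show ?thesis by (simp only: power2_eq_square ac_simps)
qed

lemma theta_psi:
  assumes "s > 0"
  shows "theta 1 s s * Eq s = 2 * Eq (2 * s) ^ 2"
proof -
  have "qpoch_inf (1::rat) 0 s = 2 * qpoch_inf 1 s s"
    using qpoch_inf_0[OF assms, of 1] by (simp add: numeral_fps_const)
  moreover have "qpoch_inf (1::rat) s s * Eq s = Eq (2 * s)"
    using qpoch_inf_plus_minus[OF assms, of 1 s] assms by (simp add: Eq_eq)
  moreover have "theta 1 s s = Eq s * (qpoch_inf 1 s s * qpoch_inf 1 0 s)"
    using assms by (simp add: theta_def Eq_eq)
  ultimately show ?thesis by algebra
qed

lemma sum_symmetric_interval_Suc:
  "(\<Sum>j\<in>{-int (Suc n)..int (Suc n)}. f j) =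
     (\<Sum>j\<in>{-int n..int n}. f j) + (f (int n + 1) + f (- int n - 1) :: 'a::comm_monoid_add)"
proof -
  have "{-int (Suc n)..int (Suc n)} = insert (int n + 1) (insert (- int n - 1) {-int n..int n})"
    by auto
  thus ?thesis by (simp add: ac_simps)
qed

text \<open>The \<open>6 n + 3\<close> indices form exactly \<open>2 n + 1\<close> triples
  \<open>3 k - 1\<close>, \<open>3 k\<close>, \<open>3 k + 1\<close>.\<close>

lemma sum_symmetric_interval_mod3:
  "(\<Sum>j\<in>{-int (3 * n + 1)..int (3 * n + 1)}. f j) =
     (\<Sum>k\<in>{-int n..int n}. f (3 * k) + f (3 * k + 1) + f (3 * k - 1) :: 'a::comm_monoid_add)"
proof (induction n)
  case 0
  have "{-1..1::int} = {-1, 0, 1}" by auto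
  thus ?case by (simp add: ac_simps)
next
  case (Suc n)
  have e: "3 * Suc n + 1 = Suc (Suc (Suc (3 * n + 1)))" by simp
  have i: "int (Suc (Suc (3 * n + 1))) + 1 = 3 * (int n + 1) + 1"
    "- int (Suc (Suc (3 * n + 1))) - 1 = 3 * (- int n - 1) - 1"
    "int (Suc (3 * n + 1)) + 1 = 3 * (int n + 1)"
    "- int (Suc (3 * n + 1)) - 1 = 3 * (- int n - 1)"
    "int (3 * n + 1) + 1 = 3 * (int n + 1) - 1"
    "- int (3 * n + 1) - 1 = 3 * (- int n - 1) + 1" by simp_all
  show ?case
    unfolding e sum_symmetric_interval_Suc Suc.IH i by (simp only: add_ac)
qed

lemma sum_symmetric_interval_uminus:
  "(\<Sum>j\<in>{-int n..int n}. f (- j)) = (\<Sum>j\<in>{-int n..int n}. f j :: 'a::comm_monoid_add)"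
  by (rule sum.reindex_bij_witness[of _ uminus uminus]) auto

lemma two_theta_exp: "2 * theta_exp a m j = int m * (j * (j - 1)) + 2 * int a * j"
proof -
  have "2 * (j * (j - 1) div 2) = j * (j - 1)" by simp
  thus ?thesis unfolding theta_exp_def by (simp only: distrib_left mult.left_commute mult.assoc)
qed

text \<open>The exponents are squares: \<open>(3 k)^2 = 9 k^2\<close> gives the first series and
  \<open>(3 k - 1)^2 = 9 k^2 - 6 k + 1\<close> the second. The residue 1 repeats the residue -1
  under \<open>j \<mapsto> -j\<close>, whence the 2.\<close>

lemma phi_trisection:
  "theta (-1 :: 'a::field) 1 2 = theta (-1) 9 18 - 2 * fps_X * theta (-1) 3 18"
proof (rule LIMSEQ_unique)
  let ?T = "\<lambda>a m n. \<Sum>j\<in>{-int n..int n}. theta_term (-1::'a) a m j"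
  show "(\<lambda>n. ?T 1 2 (3 * n + 1)) \<longlonglongrightarrow> theta (-1) 1 2"
    by (intro LIMSEQ_fps_mult_index theta_LIMSEQ) auto
  have sq: "theta_exp (Suc 0) 2 k = k ^ 2" and e1: "theta_exp 9 18 k = 9 * k ^ 2"
    and e2: "theta_exp 3 18 k = 9 * k ^ 2 - 6 * k" for k
    using two_theta_exp[of 1 2 k] two_theta_exp[of 9 18 k] two_theta_exp[of 3 18 k]
    by (simp_all add: power2_eq_square right_diff_distrib)
  have nn: "9 * k ^ 2 - 6 * k \<ge> 0" for k :: int
    using theta_exp_ge(2)[of 18 3 k] e2 by simp
  have t0: "theta_term (-1 :: 'a) 1 2 (3 * k) = theta_term (-1) 9 18 k" for k
    by (simp add: theta_term_def sq e1 power_mult_distrib power_int_mult)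
  have tm: "theta_term (-1 :: 'a) 1 2 (3 * k - 1) = - fps_X * theta_term (-1) 3 18 k" for k
  proof -
    have "nat ((3 * k - 1) ^ 2) = Suc (nat (9 * k ^ 2 - 6 * k))"
      using nn[of k] by (simp add: power2_eq_square algebra_simps nat_add_distrib Suc_nat_eq_nat_zadd1)
    moreover have "(-1 :: 'a) powi (3 * k - 1) = - ((-1) powi k)"
      by (simp add: power_int_minus_left)
    ultimately show ?thesis by (simp add: theta_term_def sq e2 ac_simps fps_const_neg [symmetric] del: fps_const_neg)
  qed
  have tp: "theta_term (-1 :: 'a) 1 2 (3 * k + 1) = - fps_X * theta_term (-1) 3 18 (- k)" for k
  proof -
    have "theta_term (-1 :: 'a) 1 2 (3 * k + 1) = theta_term (-1) 1 2 (3 * (-k) - 1)"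
      by (simp add: theta_term_def sq power2_eq_square algebra_simps power_int_minus_left)
    thus ?thesis by (simp only: tm)
  qed
  have "?T 1 2 (3 * n + 1) = ?T 9 18 n - 2 * fps_X * ?T 3 18 n" for n
    unfolding sum_symmetric_interval_mod3 t0 tp tm sum.distrib sum_distrib_left[symmetric]
      sum_symmetric_interval_uminus by simp
  moreover have "(\<lambda>n. ?T 9 18 n - 2 * fps_X * ?T 3 18 n) \<longlonglongrightarrow> theta (-1) 9 18 - 2 * fps_X * theta (-1) 3 18"
    by (intro tendsto_fps_diff tendsto_fps_mult tendsto_const theta_LIMSEQ) auto
  ultimately show "(\<lambda>n. ?T 1 2 (3 * n + 1)) \<longlonglongrightarrow> theta (-1) 9 18 - 2 * fps_X * theta (-1) 3 18"
    by (simp only:)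
qed

text \<open>The exponents are triangular numbers \<open>j (j + 1) / 2\<close>. The residues 0 and -1
  of \<open>j\<close> give the same series, and the residue 1 gives the original one in
  \<open>q^9\<close>, times \<open>q\<close>.\<close>

lemma psi_trisection:
  "theta (1 :: 'a::field) 1 1 = 2 * theta 1 3 9 + fps_X * theta 1 9 9"
proof (rule LIMSEQ_unique)
  let ?T = "\<lambda>a m n. \<Sum>j\<in>{-int n..int n}. theta_term (1::'a) a m j"
  show "(\<lambda>n. ?T 1 1 (3 * n + 1)) \<longlonglongrightarrow> theta 1 1 1"
    by (intro LIMSEQ_fps_mult_index theta_LIMSEQ) auto
  have e: "2 * theta_exp 1 1 j = j ^ 2 + j" "2 * theta_exp 3 9 j = 9 * j ^ 2 - 3 * j"
    "2 * theta_exp 9 9 j = 9 * j ^ 2 + 9 * j" for j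
    unfolding two_theta_exp by (simp_all add: power2_eq_square right_diff_distrib)
  have tm: "theta_term (1 :: 'a) 1 1 (3 * k - 1) = theta_term 1 3 9 k" for k
  proof -
    have "2 * theta_exp 1 1 (3 * k - 1) = 2 * theta_exp 3 9 k"
      unfolding e by (simp add: power2_eq_square algebra_simps)
    thus ?thesis by (simp add: theta_term_def)
  qed
  have t0: "theta_term (1 :: 'a) 1 1 (3 * k) = theta_term 1 3 9 (- k)" for k
  proof -
    have "2 * theta_exp 1 1 (3 * k) = 2 * theta_exp 3 9 (-k)"
      unfolding e by (simp add: power2_eq_square algebra_simps)
    thus ?thesis by (simp add: theta_term_def)
  qed
  have tp: "theta_term (1 :: 'a) 1 1 (3 * k + 1) = fps_X * theta_term 1 9 9 k" for k
  proof -
    have "2 * theta_exp 1 1 (3 * k + 1) = 2 * (theta_exp 9 9 k + 1)"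
      unfolding distrib_left e by (simp add: power2_eq_square algebra_simps)
    hence "nat (theta_exp 1 1 (3 * k + 1)) = Suc (nat (theta_exp 9 9 k))"
      using theta_exp_ge(2)[of 9 9 k] by (simp add: nat_add_distrib)
    thus ?thesis by (simp add: theta_term_def)
  qed
  have "?T 1 1 (3 * n + 1) = 2 * ?T 3 9 n + fps_X * ?T 9 9 n" for n
    unfolding sum_symmetric_interval_mod3 t0 tp tm sum.distrib sum_distrib_left[symmetric]
      sum_symmetric_interval_uminus by simp
  moreover have "(\<lambda>n. 2 * ?T 3 9 n + fps_X * ?T 9 9 n) \<longlonglongrightarrow> 2 * theta 1 3 9 + fps_X * theta 1 9 9"
    by (intro tendsto_fps_add tendsto_fps_mult tendsto_const theta_LIMSEQ) auto
  ultimately show "(\<lambda>n. ?T 1 1 (3 * n + 1)) \<longlonglongrightarrow> 2 * theta 1 3 9 + fps_X * theta 1 9 9"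
    by (simp only:)
qed

subsection \<open>Trisection and the cubic norm\<close>

definition sect :: "nat \<Rightarrow> 'a fps \<Rightarrow> 'a fps" where
  "sect r f = Abs_fps (\<lambda>n. fps_nth f (3 * n + r))"

lemma sect_add: "sect r (f + g) = sect r f + sect r (g :: 'a::monoid_add fps)"
  by (simp add: sect_def fps_eq_iff)

lemma nat_mod3_cases:
  fixes n :: nat
  obtains k where "n = 3 * k" | k where "n = 3 * k + 1" | k where "n = 3 * k + 2"
proof -
  have "n = 3 * (n div 3) \<or> n = 3 * (n div 3) + 1 \<or> n = 3 * (n div 3) + 2" by presburger
  thus ?thesis using that by blast
qed

lemma sect_decompose:
  fixes f :: "'a::field fps"
  shows "f = (sect 0 f oo fps_X ^ 3) + fps_X * (sect 1 f oo fps_X ^ 3) + fps_X ^ 2 * (sect 2 f oo fps_X ^ 3)"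
proof (rule fps_ext)
  fix n
  show "fps_nth f n = fps_nth ((sect 0 f oo fps_X ^ 3) + fps_X * (sect 1 f oo fps_X ^ 3)
           + fps_X ^ 2 * (sect 2 f oo fps_X ^ 3)) n"
  proof (cases n rule: nat_mod3_cases)
    case (1 k)
    have "\<not> 3 dvd 3 * k - 1" if "k > 0" using that by presburger
    moreover have "\<not> 3 dvd 3 * k - 2" if "k > 0" using that by presburger
    ultimately show ?thesis using 1
      by (auto simp: fps_nth_compose_X_power fps_X_power_mult_nth sect_def)
  next
    case (2 k)
    have "\<not> 3 dvd 3 * k + 1" by presburger
    moreover have "\<not> 3 dvd 3 * k + 1 - 2" if "k > 0" using that by presburger
    ultimately show ?thesis using 2
      by (auto simp: fps_nth_compose_X_power fps_X_power_mult_nth sect_def)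
  next
    case (3 k)
    have "\<not> 3 dvd 3 * k + 1" "\<not> 3 dvd 3 * k + 2" by presburger+
    with 3 show ?thesis
      by (auto simp: fps_nth_compose_X_power fps_X_power_mult_nth sect_def)
  qed
qed

text \<open>Uniqueness of the splitting by exponents modulo 3; the sections of a series can be read
  off any such expression.\<close>

lemma sect_eqI:
  fixes f :: "'a::field fps"
  assumes "f = (f0 oo fps_X ^ 3) + fps_X * (f1 oo fps_X ^ 3) + fps_X ^ 2 * (f2 oo fps_X ^ 3)"
  shows "sect 0 f = f0" "sect 1 f = f1" "sect 2 f = f2"
proof -
  have a: "\<not> 3 dvd 3 * k - Suc 0" if "k > 0" for k :: nat using that by presburger
  have b: "\<not> 3 dvd 3 * k - 2" if "k > 0" for k :: nat using that by presburger
  have c: "\<not> 3 dvd Suc (3 * k) - 2" if "k > 0" for k :: nat using that by presburger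
  have d: "\<not> 3 dvd Suc (3 * k)" "\<not> 3 dvd Suc (Suc (3 * k))" for k :: nat by presburger+
  show "sect 0 f = f0"
    unfolding assms by (rule fps_ext) (use a b in \<open>auto simp: fps_nth_compose_X_power fps_X_power_mult_nth sect_def\<close>)
  show "sect 1 f = f1"
    unfolding assms by (rule fps_ext) (use c d in \<open>auto simp: fps_nth_compose_X_power fps_X_power_mult_nth sect_def\<close>)
  show "sect 2 f = f2"
    unfolding assms by (rule fps_ext) (use d in \<open>auto simp: fps_nth_compose_X_power fps_X_power_mult_nth sect_def\<close>)
qed

text \<open>When residues add up to 3 or more, a factor \<open>q^3\<close> splits off, which becomes
  \<open>fps_X\<close> after renaming.\<close>

lemma sect_mult:
  fixes f g :: "'a::field fps"
  shows "sect 0 (f * g) = sect 0 f * sect 0 g + fps_X * (sect 1 f * sect 2 g + sect 2 f * sect 1 g)"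
    "sect 1 (f * g) = sect 0 f * sect 1 g + sect 1 f * sect 0 g + fps_X * (sect 2 f * sect 2 g)"
    "sect 2 (f * g) = sect 0 f * sect 2 g + sect 1 f * sect 1 g + sect 2 f * sect 0 g"
proof -
  have id: "(a0 + X * a1 + X ^ 2 * a2) * (b0 + X * b1 + X ^ 2 * b2)
    = (a0 * b0 + X ^ 3 * (a1 * b2 + a2 * b1)) + X * (a0 * b1 + a1 * b0 + X ^ 3 * (a2 * b2))
      + X ^ 2 * (a0 * b2 + a1 * b1 + a2 * b0)" for X a0 a1 a2 b0 b1 b2 :: "'a fps"
    by algebra
  have "f * g = ((sect 0 f oo fps_X ^ 3) + fps_X * (sect 1 f oo fps_X ^ 3) + fps_X ^ 2 * (sect 2 f oo fps_X ^ 3)) *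
      ((sect 0 g oo fps_X ^ 3) + fps_X * (sect 1 g oo fps_X ^ 3) + fps_X ^ 2 * (sect 2 g oo fps_X ^ 3))"
    by (simp only: sect_decompose [symmetric])
  also have "\<dots> = ((sect 0 f * sect 0 g + fps_X * (sect 1 f * sect 2 g + sect 2 f * sect 1 g)) oo fps_X ^ 3)
     + fps_X * ((sect 0 f * sect 1 g + sect 1 f * sect 0 g + fps_X * (sect 2 f * sect 2 g)) oo fps_X ^ 3)
     + fps_X ^ 2 * ((sect 0 f * sect 2 g + sect 1 f * sect 1 g + sect 2 f * sect 0 g) oo fps_X ^ 3)"
    unfolding id by (simp add: fps_compose_add_distrib fps_compose_mult_distrib)
  finally have *: "f * g = \<dots>" .
  from sect_eqI[OF *]
  show "sect 0 (f * g) = sect 0 f * sect 0 g + fps_X * (sect 1 f * sect 2 g + sect 2 f * sect 1 g)"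
    "sect 1 (f * g) = sect 0 f * sect 1 g + sect 1 f * sect 0 g + fps_X * (sect 2 f * sect 2 g)"
    "sect 2 (f * g) = sect 0 f * sect 2 g + sect 1 f * sect 1 g + sect 2 f * sect 0 g" .
qed

text \<open>
  With \<open>\<omega>\<close> a primitive cube root of unity, \<open>norm3 f\<close> is the product \<open>f(q) f(\<omega> q) f(\<omega>\<^sup>2 q)\<close>
  written as a series in \<open>q\<^sup>3\<close>, with \<open>q\<^sup>3\<close> then renamed to \<open>q\<close>.
\<close>
definition norm3 :: "'a::field fps \<Rightarrow> 'a fps" where
  "norm3 f = sect 0 f ^ 3 + fps_X * sect 1 f ^ 3 + fps_X ^ 2 * sect 2 f ^ 3
             - 3 * fps_X * (sect 0 f * sect 1 f * sect 2 f)"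

text \<open>The cubic form in the three sections is the norm form of adjoining a cube root of
  \<open>fps_X\<close>, and norm forms are multiplicative.\<close>

lemma norm3_mult: "norm3 (f * g) = norm3 f * norm3 g"
proof -
  have "(a0 * b0 + X * (a1 * b2 + a2 * b1)) ^ 3 + X * (a0 * b1 + a1 * b0 + X * (a2 * b2)) ^ 3
      + X ^ 2 * (a0 * b2 + a1 * b1 + a2 * b0) ^ 3
      - 3 * X * ((a0 * b0 + X * (a1 * b2 + a2 * b1)) * (a0 * b1 + a1 * b0 + X * (a2 * b2))
                 * (a0 * b2 + a1 * b1 + a2 * b0))
     = (a0 ^ 3 + X * a1 ^ 3 + X ^ 2 * a2 ^ 3 - 3 * X * (a0 * a1 * a2)) *
       (b0 ^ 3 + X * b1 ^ 3 + X ^ 2 * b2 ^ 3 - 3 * X * (b0 * b1 * b2))"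
    for X a0 a1 a2 b0 b1 b2 :: "'a fps"
    by algebra
  thus ?thesis unfolding norm3_def sect_mult .
qed

lemma norm3_eqI:
  fixes f :: "'a::field fps"
  assumes "f = (f0 oo fps_X ^ 3) + fps_X * (f1 oo fps_X ^ 3) + fps_X ^ 2 * (f2 oo fps_X ^ 3)"
  shows "norm3 f = f0 ^ 3 + fps_X * f1 ^ 3 + fps_X ^ 2 * f2 ^ 3 - 3 * fps_X * (f0 * f1 * f2)"
  unfolding norm3_def sect_eqI[OF assms] ..

lemma norm3_compose: "norm3 (f oo fps_X ^ 3) = f ^ 3"
  using norm3_eqI[of "f oo fps_X ^ 3" f 0 0] by simp

lemma norm3_1 [simp]: "norm3 1 = 1"
  using norm3_compose[of 1] by simp

lemma norm3_power: "norm3 (f ^ n) = norm3 f ^ n"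
  by (induction n) (auto simp: norm3_mult)

lemma tendsto_sect:
  fixes f :: "'b \<Rightarrow> 'a::group_add fps"
  assumes "(f \<longlongrightarrow> F) A"
  shows "((\<lambda>x. sect r (f x)) \<longlongrightarrow> sect r F) A"
  using assms by (simp add: tendsto_fps_iff sect_def)

lemma tendsto_norm3: "(f \<longlongrightarrow> F) A \<Longrightarrow> ((\<lambda>x. norm3 (f x)) \<longlongrightarrow> norm3 F) A"
  unfolding norm3_def
  by (intro tendsto_fps_add tendsto_fps_diff tendsto_fps_mult tendsto_fps_power tendsto_const tendsto_sect)

text \<open>The conjugates of \<open>1 - q^k\<close> coincide if 3 divides \<open>k\<close>;
  otherwise their product is \<open>1 - q^(3 k)\<close>, before \<open>q^3\<close> is
  renamed.\<close>

lemma norm3_one_minus_X_power: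
  "norm3 (1 - fps_X ^ k :: 'a::field fps) = (if 3 dvd k then (1 - fps_X ^ (k div 3)) ^ 3 else 1 - fps_X ^ k)"
proof (cases k rule: nat_mod3_cases)
  case (1 l)
  have "(1 - fps_X ^ k :: 'a fps) = (1 - fps_X ^ l) oo fps_X ^ 3"
    by (simp add: 1 fps_compose_sub_distrib power_mult flip: fps_compose_power)
  thus ?thesis using 1 by (simp add: norm3_compose)
next
  case (2 l)
  have "(1 - fps_X ^ k :: 'a fps) = (1 oo fps_X ^ 3) + fps_X * (- (fps_X ^ l) oo fps_X ^ 3) + fps_X ^ 2 * (0 oo fps_X ^ 3)"
    by (simp add: 2 fps_compose_uminus power_mult flip: fps_compose_power)
  from norm3_eqI[OF this] have "norm3 (1 - fps_X ^ k :: 'a fps) = 1 - fps_X ^ k"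
    by (simp add: 2 power_mult mult.commute[of 3])
  moreover have "\<not> 3 dvd k" using 2 by presburger
  ultimately show ?thesis by simp
next
  case (3 l)
  have X: "(fps_X :: 'a fps) ^ k = fps_X ^ 2 * (fps_X ^ 3) ^ l"
    by (simp only: 3 power_add power_mult) (rule mult.commute)
  have X': "((fps_X :: 'a fps) ^ l) ^ 3 = (fps_X ^ 3) ^ l"
    by (simp only: mult.commute flip: power_mult)
  have "(1 - fps_X ^ k :: 'a fps) = (1 oo fps_X ^ 3) + fps_X * (0 oo fps_X ^ 3) + fps_X ^ 2 * (- (fps_X ^ l) oo fps_X ^ 3)"
    by (simp add: X fps_compose_uminus flip: fps_compose_power)
  from norm3_eqI[OF this] have "norm3 (1 - fps_X ^ k :: 'a fps) = 1 - fps_X ^ k"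
    by (simp add: X X')
  moreover have "\<not> 3 dvd k" using 3 by presburger
  ultimately show ?thesis by simp
qed

text \<open>Over all indices the norms contribute \<open>E(q^m) / E(q^(3 m))\<close> from those
  prime to 3 and \<open>E(q^m)^3\<close> from the multiples of 3.\<close>

lemma norm3_Eq:
  assumes "m > 0" "\<not> 3 dvd m"
  shows "norm3 (Eq m) * Eq (3 * m) = Eq m ^ 4"
proof (rule LIMSEQ_unique)
  define P where "P a = qpoch (-1 :: rat) a a" for a
  have P_Suc: "P a (Suc n) = P a n * (1 - fps_X ^ (a * Suc n))" for a n
    by (simp add: P_def qpoch_Suc fps_const_neg [symmetric] add.commute del: fps_const_neg)
  have lim: "P a \<longlonglongrightarrow> Eq a" if "a > 0" for a
    unfolding P_def Eq_eq[OF that] by (rule qpoch_LIMSEQ) fact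
  \<comment> \<open>The finite version takes \<open>3 n\<close> factors, of which exactly
    \<open>n\<close> have an index divisible by 3.\<close>
  have id: "norm3 (P m (3 * n + 0)) * P (3 * m) n = P m (3 * n + 0) * P m n ^ 3" for n
  proof (induction n)
    case 0
    show ?case by (simp add: P_def)
  next
    case (Suc n)
    have 3: "3 * Suc n + 0 = Suc (Suc (Suc (3 * n + 0)))" by simp
    define u v w :: "rat fps" where "u = fps_X ^ (m * Suc (3 * n))"
      and "v = fps_X ^ (m * Suc (Suc (3 * n)))" and "w = fps_X ^ (m * Suc (Suc (Suc (3 * n))))"
    have "m * Suc (3 * n) = m + 3 * (m * n)" "m * Suc (Suc (3 * n)) = 2 * m + 3 * (m * n)"
      by simp_all
    hence "\<not> 3 dvd m * Suc (3 * n)" "\<not> 3 dvd m * Suc (Suc (3 * n))"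
      using assms(2) by presburger+
    hence n12: "norm3 (1 - u) = 1 - u" "norm3 (1 - v) = 1 - v"
      by (simp_all only: u_def v_def norm3_one_minus_X_power if_False)
    have "m * Suc (Suc (Suc (3 * n))) = 3 * (m * Suc n)" by simp
    hence n3: "norm3 (1 - w) = (1 - fps_X ^ (m * Suc n)) ^ 3"
      by (simp only: w_def norm3_one_minus_X_power) simp
    have w: "w = fps_X ^ (3 * m * Suc n)" by (simp add: w_def algebra_simps)
    have "norm3 (P m (3 * Suc n + 0)) * P (3 * m) (Suc n) =
       (norm3 (P m (3 * n + 0)) * P (3 * m) n) * ((1 - u) * (1 - v) * (1 - fps_X ^ (m * Suc n)) ^ 3 * (1 - w))"
      unfolding 3 P_Suc norm3_mult by (simp only: add_0_right flip: u_def v_def w_def w) (simp only: n12 n3 ac_simps)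
    also have "\<dots> = P m (3 * Suc n + 0) * P m (Suc n) ^ 3"
      unfolding Suc.IH 3 P_Suc power_mult_distrib
      by (simp only: add_0_right flip: u_def v_def w_def) (simp only: ac_simps)
    finally show ?case .
  qed
  show "(\<lambda>n. norm3 (P m (3 * n + 0)) * P (3 * m) n) \<longlonglongrightarrow> norm3 (Eq m) * Eq (3 * m)"
    by (intro tendsto_fps_mult tendsto_norm3 LIMSEQ_fps_mult_index lim) (use assms in auto)
  have "(\<lambda>n. P m (3 * n + 0) * P m n ^ 3) \<longlonglongrightarrow> Eq m * Eq m ^ 3"
    by (intro tendsto_fps_mult tendsto_fps_power LIMSEQ_fps_mult_index lim) (use assms in auto)
  thus "(\<lambda>n. norm3 (P m (3 * n + 0)) * P (3 * m) n) \<longlonglongrightarrow> Eq m ^ 4"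
    unfolding id by (simp add: eval_nat_numeral)
qed

subsection \<open>Parametrisation by the trisection parameter\<close>

definition Xf :: "rat fps" where
  "Xf = Eq 2 ^ 4 * Eq 3 ^ 8 * inverse (Eq 1 ^ 8 * Eq 6 ^ 4)"

text \<open>The power series \<open>q^2 \<xi>\<close>, that is, \<open>xi\<close> without its
  pole.\<close>

definition xif :: "rat fps" where
  "xif = Eq 2 ^ 5 * Eq 9 ^ 4 * inverse (Eq 1 ^ 4 * Eq 18 ^ 5)"

text \<open>
  \<open>w1\<close> is, up to a constant, the ratio of the two components in the trisection of \<open>phi\<close>, and also the inverse of the ratio
  in the trisection of \<open>psi\<close>; hence both \<open>X\<close> and \<open>\<xi>\<close> are rational functions of \<open>pp = q w1(q\<^sup>3)\<close>.
\<close>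
definition w1 :: "rat fps" where
  "w1 = Eq 1 * Eq 6 ^ 3 * inverse (Eq 2 * Eq 3 ^ 3)"

definition w3 :: "rat fps" where "w3 = w1 oo fps_X ^ 3"
definition pp :: "rat fps" where "pp = fps_X * w3"
definition Yf :: "rat fps" where "Yf = Xf oo fps_X ^ 3"

lemma mult_inverse_unit: "fps_nth g 0 \<noteq> 0 \<Longrightarrow> f * inverse g * g = (f :: 'a::field fps)"
  by (metis inverse_mult_eq_1 mult.assoc mult.right_neutral)

lemma Xf_mult: "Xf * (Eq 1 ^ 8 * Eq 6 ^ 4) = Eq 2 ^ 4 * Eq 3 ^ 8"
  unfolding Xf_def by (rule mult_inverse_unit) (simp add: Eq_nth_0 fps_power_zeroth)

lemma xif_mult: "xif * (Eq 1 ^ 4 * Eq 18 ^ 5) = Eq 2 ^ 5 * Eq 9 ^ 4"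
  unfolding xif_def by (rule mult_inverse_unit) (simp add: Eq_nth_0 fps_power_zeroth)

lemma w1_mult: "w1 * (Eq 2 * Eq 3 ^ 3) = Eq 1 * Eq 6 ^ 3"
  unfolding w1_def by (rule mult_inverse_unit) (simp add: Eq_nth_0 fps_power_zeroth)

lemma w3_mult: "w3 * (Eq 6 * Eq 9 ^ 3) = Eq 3 * Eq 18 ^ 3"
  using arg_cong[OF w1_mult, of "\<lambda>f. f oo fps_X ^ 3"]
  by (simp add: fps_compose_mult_distrib Eq_compose w3_def flip: fps_compose_power)

lemma w1_nonzero: "w1 \<noteq> 0"
  using w1_mult Eq_nonzero[of 1] Eq_nonzero[of 6] by auto

text \<open>This is \<open>\<phi>(-q^s)\<close>; the sign is part of the definition.\<close>

definition phi :: "nat \<Rightarrow> rat fps" where "phi s = theta (-1) s (2 * s)"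

lemma phi_mult: "s > 0 \<Longrightarrow> phi s * Eq (2 * s) = Eq s ^ 2"
  unfolding phi_def by (rule theta_phi)

lemma phi_nonzero: "s > 0 \<Longrightarrow> phi s \<noteq> 0"
  using phi_mult[of s] Eq_nonzero[of s] by auto

lemma phi_compose: "s > 0 \<Longrightarrow> phi s oo fps_X ^ 3 = phi (3 * s)"
  by (simp add: phi_def theta_def fps_compose_mult_distrib qpoch_inf_compose_X_power diff_mult_distrib2)

lemma mult_right_cancelD: "x * z = y * z \<Longrightarrow> z \<noteq> 0 \<Longrightarrow> x = (y :: 'a::idom)"
  by simp

text \<open>The trisection, with the ratio of its two components identified as \<open>w3\<close>
  through their eta quotients.\<close>

lemma phi1_eq: "phi 1 = phi 9 * (1 - 2 * pp)"
proof -
  have "theta (-1) 3 18 = w3 * phi 9"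
  proof (rule mult_right_cancelD)
    have "phi 9 * Eq 18 = Eq 9 ^ 2" using phi_mult[of 9] by simp
    moreover have "theta (-1) 3 18 * (Eq 6 * Eq 9) = Eq 3 * Eq 18 ^ 2"
      using theta_omega[of 3] by simp
    ultimately show "theta (-1) 3 18 * (Eq 6 * Eq 9 ^ 3 * Eq 18) = w3 * phi 9 * (Eq 6 * Eq 9 ^ 3 * Eq 18)"
      using w3_mult by algebra
  qed (simp add: Eq_nonzero)
  moreover have "phi 1 = theta (-1) 1 2" "phi 9 = theta (-1) 9 18"
    unfolding phi_def by simp_all
  ultimately show ?thesis
    using phi_trisection[where 'a = rat] unfolding pp_def by algebra
qed

text \<open>This is \<open>\<psi>(q^s)\<close>. The bilateral series takes each exponent twice, at
  \<open>j\<close> and at \<open>-1 - j\<close>, hence the halving.\<close>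

definition psi :: "nat \<Rightarrow> rat fps" where "psi s = fps_const (1 / 2) * theta 1 s s"

lemma two_psi: "2 * psi s = theta 1 s s"
proof -
  have "2 * psi s = fps_const 2 * fps_const (1 / 2) * theta 1 s s"
    unfolding psi_def by (simp add: numeral_fps_const mult.assoc del: fps_const_mult)
  thus ?thesis by simp
qed

lemma psi_mult:
  assumes "s > 0"
  shows "psi s * Eq s = Eq (2 * s) ^ 2"
proof -
  have "2 * (psi s * Eq s) = 2 * Eq (2 * s) ^ 2"
    using theta_psi[OF assms] two_psi[of s] by (simp add: mult.assoc [symmetric])
  thus ?thesis by simp
qed

lemma psi_nonzero: "s > 0 \<Longrightarrow> psi s \<noteq> 0"
  using psi_mult[of s] Eq_nonzero[of "2 * s"] by auto

text \<open>Multiplication by \<open>w3\<close> replaces the division by \<open>p\<close> in the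
  trisection of \<open>\<psi>\<close>.\<close>

lemma psi1_eq: "w3 * psi 1 = psi 9 * (1 + pp)"
proof -
  have *: "w3 * theta 1 3 9 = psi 9"
  proof (rule mult_right_cancelD)
    have "psi 9 * Eq 9 = Eq 18 ^ 2" using psi_mult[of 9] by simp
    moreover have "theta 1 3 9 * (Eq 3 * Eq 18) = Eq 6 * Eq 9 ^ 2"
      using theta_f[of 3] by simp
    ultimately show "w3 * theta 1 3 9 * (Eq 6 * Eq 9 ^ 3 * Eq 3 * Eq 18) = psi 9 * (Eq 6 * Eq 9 ^ 3 * Eq 3 * Eq 18)"
      using w3_mult by algebra
  qed (simp add: Eq_nonzero)
  have "2 * psi 1 = 2 * theta 1 3 9 + fps_X * (2 * psi 9)"
    unfolding two_psi by (rule psi_trisection)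
  hence "2 * (psi 1) = 2 * (theta 1 3 9 + fps_X * psi 9)"
    by (simp only: distrib_left mult.left_commute)
  hence "psi 1 = theta 1 3 9 + fps_X * psi 9"
    by (simp only: mult_cancel_left) simp
  thus ?thesis using * by (simp add: pp_def algebra_simps)
qed

text \<open>Norms are taken in \<open>\<phi>(-q) = E(q)^2 / E(q^2)\<close> and evaluated by
  \<open>norm3_Eq\<close>.\<close>

lemma norm3_phi: "norm3 (phi 1) * phi 3 = phi 1 ^ 4"
proof (rule mult_right_cancelD)
  have "norm3 (phi 1) * norm3 (Eq 2) = norm3 (Eq 1) ^ 2"
    using arg_cong[OF phi_mult[of 1], of norm3] by (simp add: norm3_mult norm3_power)
  moreover have "norm3 (Eq 2) * Eq 6 = Eq 2 ^ 4" "norm3 (Eq 1) * Eq 3 = Eq 1 ^ 4"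
    using norm3_Eq[of 2] norm3_Eq[of 1] by simp_all
  moreover have "phi 3 * Eq 6 = Eq 3 ^ 2" "phi 1 * Eq 2 = Eq 1 ^ 2"
    using phi_mult[of 3] phi_mult[of 1] by simp_all
  moreover have "n * h * (c ^ 2 * b ^ 4 * d) = x ^ 4 * (c ^ 2 * b ^ 4 * d)"
    if "n * m2 = m1 ^ 2" "m2 * d = b ^ 4" "m1 * c = a ^ 4" "h * d = c ^ 2" "x * b = a ^ 2"
    for n h m1 m2 a b c d x :: "rat fps"
  proof -
    have "n * h * (c ^ 2 * b ^ 4 * d) = n * (h * d) * c ^ 2 * (m2 * d)"
      using that(2) by algebra
    also have "\<dots> = (n * m2) * c ^ 4 * d"
      unfolding that(4) by algebra
    also have "\<dots> = (m1 * c) ^ 2 * c ^ 2 * d"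
      unfolding that(1) by algebra
    also have "\<dots> = (x * b) ^ 4 * c ^ 2 * d"
      unfolding that(3) that(5) by algebra
    finally show ?thesis by algebra
  qed
  ultimately show "norm3 (phi 1) * phi 3 * (Eq 3 ^ 2 * Eq 2 ^ 4 * Eq 6) = phi 1 ^ 4 * (Eq 3 ^ 2 * Eq 2 ^ 4 * Eq 6)"
    by blast
qed (simp add: Eq_nonzero)

lemma Xf_phi: "Xf * phi 1 ^ 4 = phi 3 ^ 4"
proof (rule mult_right_cancelD)
  have "phi 3 * Eq 6 = Eq 3 ^ 2" "phi 1 * Eq 2 = Eq 1 ^ 2"
    using phi_mult[of 3] phi_mult[of 1] by simp_all
  moreover have "x * f ^ 4 * (b ^ 4 * d ^ 4) = g ^ 4 * (b ^ 4 * d ^ 4)"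
    if "g * d = c ^ 2" "f * b = a ^ 2" "x * (a ^ 8 * d ^ 4) = b ^ 4 * c ^ 8" for x f g a b c d :: "rat fps"
  proof -
    have "x * f ^ 4 * (b ^ 4 * d ^ 4) = x * (f * b) ^ 4 * d ^ 4" by algebra
    also have "\<dots> = x * (a ^ 8 * d ^ 4)" unfolding that(2) by algebra
    also have "\<dots> = b ^ 4 * (c ^ 2) ^ 4" unfolding that(3) by algebra
    finally show ?thesis unfolding that(1)[symmetric] by algebra
  qed
  ultimately show "Xf * phi 1 ^ 4 * (Eq 2 ^ 4 * Eq 6 ^ 4) = phi 3 ^ 4 * (Eq 2 ^ 4 * Eq 6 ^ 4)"
    using Xf_mult by blast
qed (simp add: Eq_nonzero)

text \<open>Taking norms in \<open>phi1_eq\<close> gives \<open>phi 3 ^ 3\<close> times the norm of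
  \<open>1 - 2 * pp\<close>; comparison with \<open>norm3_phi\<close> and \<open>Xf_phi\<close>
  leaves the claim.\<close>

lemma Xf_w1: "Xf * (1 - 8 * fps_X * w1 ^ 3) = 1"
proof -
  have c: "1 - 2 * pp = (1 oo fps_X ^ 3) + fps_X * ((- 2 * w1) oo fps_X ^ 3) + fps_X ^ 2 * (0 oo fps_X ^ 3)"
    by (simp add: pp_def w3_def fps_compose_mult_distrib fps_compose_uminus)
  have n: "norm3 (1 - 2 * pp) = 1 - 8 * fps_X * w1 ^ 3"
    using norm3_eqI[OF c] by (simp add: power_mult_distrib)
  have "norm3 (phi 1) = phi 3 ^ 3 * (1 - 8 * fps_X * w1 ^ 3)"
    unfolding phi1_eq norm3_mult n using phi_compose[of 3] norm3_compose[of "phi 3"] by simp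
  hence "phi 1 ^ 4 = phi 3 ^ 4 * (1 - 8 * fps_X * w1 ^ 3)"
    using norm3_phi by algebra
  hence "(Xf * (1 - 8 * fps_X * w1 ^ 3)) * phi 3 ^ 4 = 1 * phi 3 ^ 4"
    using Xf_phi by algebra
  thus ?thesis by (rule mult_right_cancelD) (simp add: phi_nonzero)
qed

lemma Yf_pp: "Yf * (1 - 8 * pp ^ 3) = 1"
proof -
  have "Yf * (1 - 8 * (fps_X ^ 3 * w3 ^ 3)) = 1"
    using arg_cong[OF Xf_w1, of "\<lambda>f. f oo fps_X ^ 3"]
    by (simp add: fps_compose_mult_distrib fps_compose_sub_distrib Yf_def w3_def mult.assoc flip: fps_compose_power)
  thus ?thesis by (simp add: pp_def power_mult_distrib)
qed

text \<open>\<open>Xf_phi\<close> at \<open>q\<close> and at \<open>q^3\<close> combine to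
  \<open>X Y (1 - 2 p)^4 = 1\<close>, and \<open>1 / (1 - 2 p) = Y (1 + 2 p + 4 p^2)\<close> by
  factoring \<open>1 - 8 p^3\<close>.\<close>

lemma Xf_pp: "Xf = (1 + 2 * pp + 4 * pp ^ 2) ^ 4 * Yf ^ 3"
proof -
  have "Yf * phi 3 ^ 4 = phi 9 ^ 4"
    using arg_cong[OF Xf_phi, of "\<lambda>f. f oo fps_X ^ 3"]
    by (simp add: fps_compose_mult_distrib phi_compose Yf_def flip: fps_compose_power)
  moreover have "Xf * (phi 9 * (1 - 2 * pp)) ^ 4 = phi 3 ^ 4"
    using Xf_phi phi1_eq by simp
  ultimately have "(Xf * Yf * (1 - 2 * pp) ^ 4) * phi 9 ^ 4 = 1 * phi 9 ^ 4"
    by algebra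
  hence 1: "Xf * Yf * (1 - 2 * pp) ^ 4 = 1"
    by (rule mult_right_cancelD) (simp add: phi_nonzero)
  have 2: "Yf * (1 - 2 * pp) * (1 + 2 * pp + 4 * pp ^ 2) = 1"
    using Yf_pp by algebra
  have "Xf = Xf * (Yf * (1 - 2 * pp) * (1 + 2 * pp + 4 * pp ^ 2)) ^ 4"
    by (simp add: 2)
  also have "\<dots> = (Xf * Yf * (1 - 2 * pp) ^ 4) * ((1 + 2 * pp + 4 * pp ^ 2) ^ 4 * Yf ^ 3)"
    by algebra
  finally show ?thesis by (simp add: 1)
qed

text \<open>The quotient splits as \<open>\<psi>^2 / \<phi>\<close> at level 1 divided by the same
  quotient at level 9.\<close>

lemma xif_phi_psi: "xif * (phi 1 * psi 9 ^ 2) = psi 1 ^ 2 * phi 9"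
proof (rule mult_right_cancelD)
  have r: "phi 1 * Eq 2 = Eq 1 ^ 2" "psi 9 * Eq 9 = Eq 18 ^ 2" "psi 1 * Eq 1 = Eq 2 ^ 2" "phi 9 * Eq 18 = Eq 9 ^ 2"
    using phi_mult[of 1] psi_mult[of 9] psi_mult[of 1] phi_mult[of 9] by simp_all
  have *: "x * (f * g ^ 2) * (b * n ^ 2 * a ^ 2 * m) = h ^ 2 * k * (b * n ^ 2 * a ^ 2 * m)"
    if "f * b = a ^ 2" "g * n = m ^ 2" "h * a = b ^ 2" "k * m = n ^ 2" "x * (a ^ 4 * m ^ 5) = b ^ 5 * n ^ 4"
    for x f g h k a b n m :: "rat fps"
  proof -
    have "x * (f * g ^ 2) * (b * n ^ 2 * a ^ 2 * m) = x * (f * b) * (g * n) ^ 2 * a ^ 2 * m" by algebra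
    also have "\<dots> = x * (a ^ 4 * m ^ 5)" unfolding that(1,2) by algebra
    also have "\<dots> = (b ^ 2) ^ 2 * n ^ 2 * (b * n ^ 2)" unfolding that(5) by algebra
    finally show ?thesis unfolding that(3)[symmetric] using that(4) by algebra
  qed
  show "xif * (phi 1 * psi 9 ^ 2) * (Eq 2 * Eq 9 ^ 2 * Eq 1 ^ 2 * Eq 18) =
        psi 1 ^ 2 * phi 9 * (Eq 2 * Eq 9 ^ 2 * Eq 1 ^ 2 * Eq 18)"
    by (rule *[OF r xif_mult])
qed (simp add: Eq_nonzero)

text \<open>The factor \<open>w3 ^ 3\<close> clears the negative powers of \<open>p\<close> and,
  being a series in \<open>q^3\<close>, passes through the trisection. The factor
  \<open>fps_X\<close> completes \<open>xif\<close> to \<open>q^3 \<xi>\<close>.\<close>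

lemma xif_pp: "fps_X * xif * w3 ^ 3 = pp * (1 + pp) ^ 2 * (1 + 2 * pp + 4 * pp ^ 2) * Yf"
proof -
  have "xif * (phi 9 * (1 - 2 * pp) * psi 9 ^ 2) = psi 1 ^ 2 * phi 9"
    using xif_phi_psi phi1_eq by simp
  hence "(xif * (1 - 2 * pp) * w3 ^ 2) * (phi 9 * psi 9 ^ 2) = (1 + pp) ^ 2 * (phi 9 * psi 9 ^ 2)"
    using psi1_eq by algebra
  hence "xif * (1 - 2 * pp) * w3 ^ 2 = (1 + pp) ^ 2"
    by (rule mult_right_cancelD) (simp add: phi_nonzero psi_nonzero)
  moreover have "Yf * (1 - 2 * pp) * (1 + 2 * pp + 4 * pp ^ 2) = 1"
    using Yf_pp by algebra
  moreover have "pp = fps_X * w3" by (rule pp_def)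
  ultimately show ?thesis by algebra
qed

subsection \<open>Reduction modulo the cubic relation\<close>

text \<open>
  The relation \<open>Y (1 - 8 p\<^sup>3) = 1\<close> reduces every polynomial to degree at most two in \<open>p\<close>. The explicit
  factors of \<open>Y (1 - 8 p\<^sup>3) - 1\<close> in the proofs are the quotients of these divisions.
\<close>
lemma reduction_X:
  fixes p Y X :: "'a::idom"
  assumes "Y * (1 - 8 * p ^ 3) = 1" "X = (1 + 2 * p + 4 * p ^ 2) ^ 4 * Y ^ 3"
  shows "X = (10 * Y - 36 * Y ^ 2 + 27 * Y ^ 3) + (8 * Y - 54 * Y ^ 2 + 54 * Y ^ 3) * p
             + (4 * Y - 72 * Y ^ 2 + 108 * Y ^ 3) * p ^ 2" (is "_ = ?R")
proof -
  have "X = ?R + (10 * Y - 26 * Y ^ 2 + 8 * Y * p - 46 * Y ^ 2 * p + 4 * Y * p ^ 2 - 68 * Y ^ 2 * p ^ 2 - 80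
      * Y ^ 2 * p ^ 3 - 64 * Y ^ 2 * p ^ 4 - 32 * Y ^ 2 * p ^ 5) * (Y * (1 - 8 * p ^ 3) - 1)"
    unfolding assms(2) by algebra
  thus ?thesis using assms(1) by simp
qed

lemma reduction_X2:
  fixes p Y X :: "'a::idom"
  assumes "Y * (1 - 8 * p ^ 3) = 1"
    and "X = (10 * Y - 36 * Y ^ 2 + 27 * Y ^ 3) + (8 * Y - 54 * Y ^ 2 + 54 * Y ^ 3) * p
             + (4 * Y - 72 * Y ^ 2 + 108 * Y ^ 3) * p ^ 2"
  shows "X ^ 2 = (-8 * Y + 306 * Y ^ 2 - 2160 * Y ^ 3 + 5508 * Y ^ 4 - 5832 * Y ^ 5 + 2187 * Y ^ 6)
      + (-2 * Y + 234 * Y ^ 2 - 2484 * Y ^ 3 + 8100 * Y ^ 4 - 10206 * Y ^ 5 + 4374 * Y ^ 6) * p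
      + (144 * Y ^ 2 - 2592 * Y ^ 3 + 11340 * Y ^ 4 - 17496 * Y ^ 5 + 8748 * Y ^ 6) * p ^ 2" (is "_ = ?R")
proof -
  have "X ^ 2 = ?R + (-8 * Y + 198 * Y ^ 2 - 1242 * Y ^ 3 + 2430 * Y ^ 4 - 1458 * Y ^ 5 - 2 * Y * p + 72 * Y ^ 2
      * p - 756 * Y ^ 3 * p + 1944 * Y ^ 4 * p - 1458 * Y ^ 5 * p) * (Y * (1 - 8 * p ^ 3) - 1)"
    unfolding assms(2) by algebra
  thus ?thesis using assms(1) by simp
qed

text \<open>Powers of \<open>p\<close> reduce to degree at most two, so eliminating \<open>p\<close>
  leaves a cubic for \<open>X\<close>; its coefficients are those of the matrix recurrence.\<close>

lemma modular_equation:
  fixes p Y X :: "'a::idom"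
  assumes "Y * (1 - 8 * p ^ 3) = 1" "X = (1 + 2 * p + 4 * p ^ 2) ^ 4 * Y ^ 3"
  shows "X ^ 3 = (30 * Y - 108 * Y ^ 2 + 81 * Y ^ 3) * X ^ 2 + (9 * Y ^ 2 - 12 * Y) * X + Y"
proof -
  note X = reduction_X[OF assms]
  define Z where "Z = X ^ 2"
  note Z = reduction_X2[OF assms(1) X, folded Z_def]
  have "X * Z = (30 * Y - 108 * Y ^ 2 + 81 * Y ^ 3) * Z + (9 * Y ^ 2 - 12 * Y) * X + Y
      + (Y - 279 * Y ^ 2 + 6939 * Y ^ 3 - 59373 * Y ^ 4 + 223074 * Y ^ 5 - 406782 * Y ^ 6 + 354294
      * Y ^ 7 - 118098 * Y ^ 8 - 72 * Y ^ 2 * p + 2592 * Y ^ 3 * p - 30942 * Y ^ 4 * p + 145800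
      * Y ^ 5 * p - 314928 * Y ^ 6 * p + 314928 * Y ^ 7 * p - 118098 * Y ^ 8 * p) * (Y * (1 - 8 * p ^ 3) - 1)"
    unfolding Z unfolding X by algebra
  thus ?thesis using assms(1) by (simp add: Z_def power3_eq_cube power2_eq_square mult.assoc)
qed

text \<open>The 8 clears the denominator in \<open>p^3 = (Y - 1) / (8 Y)\<close>.\<close>

lemma reduction_h:
  fixes p Y h :: "'a::idom"
  assumes "Y * (1 - 8 * p ^ 3) = 1" "h = p * (1 + p) ^ 2 * (1 + 2 * p + 4 * p ^ 2) * Y"
  shows "8 * h = (9 * Y - 9) + (18 * Y - 10) * p + (36 * Y - 4) * p ^ 2" (is "_ = ?R")
proof -
  have "8 * h = ?R + (-9 - 10 * p - 4 * p ^ 2) * (Y * (1 - 8 * p ^ 3) - 1)"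
    unfolding assms(2) by algebra
  thus ?thesis using assms(1) by simp
qed

lemma reduction_hX:
  fixes p Y X h :: "'a::idom"
  assumes "Y * (1 - 8 * p ^ 3) = 1"
    and "X = (10 * Y - 36 * Y ^ 2 + 27 * Y ^ 3) + (8 * Y - 54 * Y ^ 2 + 54 * Y ^ 3) * p
             + (4 * Y - 72 * Y ^ 2 + 108 * Y ^ 3) * p ^ 2"
    and "8 * h = (9 * Y - 9) + (18 * Y - 10) * p + (36 * Y - 4) * p ^ 2"
  shows "8 * (h * X) = (9 - 261 * Y + 1143 * Y ^ 2 - 1620 * Y ^ 3 + 729 * Y ^ 4)
      + (2 - 228 * Y + 1530 * Y ^ 2 - 2754 * Y ^ 3 + 1458 * Y ^ 4) * p
      + (-156 * Y + 1872 * Y ^ 2 - 4536 * Y ^ 3 + 2916 * Y ^ 4) * p ^ 2" (is "_ = ?R")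
proof -
  have "8 * h * X = ?R + (9 - 162 * Y + 567 * Y ^ 2 - 486 * Y ^ 3 + 2 * p - 54 * Y * p + 378 * Y ^ 2 * p - 486 * Y ^
      3 * p) * (Y * (1 - 8 * p ^ 3) - 1)"
    unfolding assms(2,3) by algebra
  thus ?thesis using assms(1) by (simp add: mult.assoc)
qed

lemma reduction_hX2:
  fixes p Y X h :: "'a::idom"
  assumes "Y * (1 - 8 * p ^ 3) = 1"
    and "X = (10 * Y - 36 * Y ^ 2 + 27 * Y ^ 3) + (8 * Y - 54 * Y ^ 2 + 54 * Y ^ 3) * p
             + (4 * Y - 72 * Y ^ 2 + 108 * Y ^ 3) * p ^ 2"
    and "8 * (h * X) = (9 - 261 * Y + 1143 * Y ^ 2 - 1620 * Y ^ 3 + 729 * Y ^ 4)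
      + (2 - 228 * Y + 1530 * Y ^ 2 - 2754 * Y ^ 3 + 1458 * Y ^ 4) * p
      + (-156 * Y + 1872 * Y ^ 2 - 4536 * Y ^ 3 + 2916 * Y ^ 4) * p ^ 2"
  shows "8 * (h * X ^ 2) = (-1 + 379 * Y - 8991 * Y ^ 2 + 63288 * Y ^ 3 - 193185 * Y ^ 4
        + 289413 * Y ^ 5 - 209952 * Y ^ 6 + 59049 * Y ^ 7)
      + (170 * Y - 7344 * Y ^ 2 + 70848 * Y ^ 3 - 266328 * Y ^ 4 + 465102 * Y ^ 5
        - 380538 * Y ^ 6 + 118098 * Y ^ 7) * p
      + (52 * Y - 5184 * Y ^ 2 + 73332 * Y ^ 3 - 350892 * Y ^ 4 + 729000 * Y ^ 5
        - 682344 * Y ^ 6 + 236196 * Y ^ 7) * p ^ 2" (is "_ = ?R")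
proof -
  have "8 * (h * X) * X = ?R + (-1 + 288 * Y - 5769 * Y ^ 2 + 36450 * Y ^ 3 - 92340 * Y ^ 4 + 100602 * Y ^ 5 - 39366 * Y ^
      6 + 78 * Y * p - 2340 * Y ^ 2 * p + 21222 * Y ^ 3 * p - 67554 * Y ^ 4 * p + 87480 * Y ^ 5
      * p - 39366 * Y ^ 6 * p) * (Y * (1 - 8 * p ^ 3) - 1)"
    unfolding assms(3) unfolding assms(2) by algebra
  thus ?thesis using assms(1) by (simp add: mult.assoc power2_eq_square)
qed

subsection \<open>Action of the trisection on powers of X\<close>

lemma sect_compose:
  "sect 0 (f oo fps_X ^ 3) = (f :: 'a::field fps)" "sect 1 (f oo fps_X ^ 3) = 0" "sect 2 (f oo fps_X ^ 3) = 0"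
  using sect_eqI[of "f oo fps_X ^ 3" f 0 0] by auto

text \<open>The operator \<open>U\<close> is linear over series in \<open>q^3\<close>; this is how
  \<open>Y\<close> turns into \<open>X\<close>.\<close>

lemma sect_0_compose_mult: "sect 0 ((f oo fps_X ^ 3) * g) = f * sect 0 (g :: 'a::field fps)"
  unfolding sect_mult sect_compose by simp

text \<open>As \<open>p = q w1(q^3)\<close>, the terms with \<open>p\<close> and \<open>p^2\<close>
  live on exponents congruent to 1 and 2 modulo 3.\<close>

lemma sect_0_pp: "sect 0 ((A oo fps_X ^ 3) + (B oo fps_X ^ 3) * pp + (C oo fps_X ^ 3) * pp ^ 2) = A"
proof -
  have "(A oo fps_X ^ 3) + (B oo fps_X ^ 3) * pp + (C oo fps_X ^ 3) * pp ^ 2 =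
    (A oo fps_X ^ 3) + fps_X * (B * w1 oo fps_X ^ 3) + fps_X ^ 2 * (C * w1 ^ 2 oo fps_X ^ 3)"
    by (simp add: pp_def w3_def fps_compose_mult_distrib power_mult_distrib flip: fps_compose_power)
  from sect_eqI(1)[OF this] show ?thesis .
qed

lemmas compose_simps = fps_compose_add_distrib fps_compose_sub_distrib fps_compose_mult_distrib
  fps_compose_uminus fps_compose_power [symmetric] Yf_def [symmetric]

text \<open>The modular equation times \<open>f * Xf ^ i\<close>, after applying \<open>U\<close>.
  The choice \<open>f = 1\<close> serves the matrix \<open>a\<close>, and
  \<open>f = q^3 \<xi>\<close> the matrix \<open>b\<close>.\<close>

lemma sect_Xf_rec:
  "sect 0 (f * Xf ^ (i + 3)) = (30 * Xf - 108 * Xf ^ 2 + 81 * Xf ^ 3) * sect 0 (f * Xf ^ (i + 2))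
     + (9 * Xf ^ 2 - 12 * Xf) * sect 0 (f * Xf ^ (i + 1)) + Xf * sect 0 (f * Xf ^ i)"
proof -
  have "f * Xf ^ (i + 3) = f * Xf ^ i * Xf ^ 3" by (simp add: power_add)
  also have "\<dots> = (30 * Yf - 108 * Yf ^ 2 + 81 * Yf ^ 3) * (f * Xf ^ (i + 2))
     + (9 * Yf ^ 2 - 12 * Yf) * (f * Xf ^ (i + 1)) + Yf * (f * Xf ^ i)"
    unfolding modular_equation[OF Yf_pp Xf_pp] power_add by (simp add: algebra_simps)
  also have "\<dots> = ((30 * Xf - 108 * Xf ^ 2 + 81 * Xf ^ 3) oo fps_X ^ 3) * (f * Xf ^ (i + 2))
     + ((9 * Xf ^ 2 - 12 * Xf) oo fps_X ^ 3) * (f * Xf ^ (i + 1)) + (Xf oo fps_X ^ 3) * (f * Xf ^ i)"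
    by (simp add: compose_simps)
  finally show ?thesis by (simp only: sect_add sect_0_compose_mult)
qed

lemma sect_1: "sect 0 (1 :: 'a::field fps) = 1"
  using sect_compose(1)[of 1] by simp

lemma sect_Xf: "sect 0 Xf = 10 * Xf - 36 * Xf ^ 2 + 27 * Xf ^ 3"
proof -
  have "Xf = ((10 * Xf - 36 * Xf ^ 2 + 27 * Xf ^ 3) oo fps_X ^ 3)
     + ((8 * Xf - 54 * Xf ^ 2 + 54 * Xf ^ 3) oo fps_X ^ 3) * pp
     + ((4 * Xf - 72 * Xf ^ 2 + 108 * Xf ^ 3) oo fps_X ^ 3) * pp ^ 2"
    using reduction_X[OF Yf_pp Xf_pp] by (simp add: compose_simps)
  from arg_cong[OF this, of "sect 0"] show ?thesis unfolding sect_0_pp .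
qed

lemma sect_Xf2:
  "sect 0 (Xf ^ 2) = -8 * Xf + 306 * Xf ^ 2 - 2160 * Xf ^ 3 + 5508 * Xf ^ 4 - 5832 * Xf ^ 5 + 2187 * Xf ^ 6"
proof -
  have "Xf ^ 2 = ((-8 * Xf + 306 * Xf ^ 2 - 2160 * Xf ^ 3 + 5508 * Xf ^ 4 - 5832 * Xf ^ 5 + 2187 * Xf ^ 6) oo fps_X ^ 3)
      + ((-2 * Xf + 234 * Xf ^ 2 - 2484 * Xf ^ 3 + 8100 * Xf ^ 4 - 10206 * Xf ^ 5 + 4374 * Xf ^ 6) oo fps_X ^ 3) * pp
      + ((144 * Xf ^ 2 - 2592 * Xf ^ 3 + 11340 * Xf ^ 4 - 17496 * Xf ^ 5 + 8748 * Xf ^ 6) oo fps_X ^ 3) * pp ^ 2"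
    by (rule trans[OF reduction_X2[OF Yf_pp reduction_X[OF Yf_pp Xf_pp]]]) (simp add: compose_simps)
  from arg_cong[OF this, of "sect 0"] show ?thesis unfolding sect_0_pp .
qed

lemma Xf_nonzero: "Xf \<noteq> 0"
  using Xf_w1 by auto

text \<open>
  Since \<open>8 q w1\<^sup>3 X = X - 1\<close>, dividing the constant term \<open>A\<close> by \<open>8 w1\<^sup>3\<close> leaves \<open>q\<close> times a polynomial in \<open>X\<close>
  whenever \<open>X - 1\<close> divides \<open>A\<close>.
\<close>
lemma sect_xif_eqI:
  assumes "8 * (fps_X * xif * w3 ^ 3 * f) =
      (A oo fps_X ^ 3) + (B oo fps_X ^ 3) * pp + (C oo fps_X ^ 3) * pp ^ 2"
    and "Xf * A = (Xf - 1) * S"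
  shows "sect 0 (fps_X * xif * f) = fps_X * S"
proof -
  have "8 * (fps_X * xif * w3 ^ 3 * f) = (8 * w1 ^ 3 oo fps_X ^ 3) * (fps_X * xif * f)"
    by (simp add: w3_def fps_compose_mult_distrib ac_simps flip: fps_compose_power)
  hence "8 * w1 ^ 3 * sect 0 (fps_X * xif * f) = A"
    using arg_cong[OF assms(1), of "sect 0"] unfolding sect_0_pp by (simp only: sect_0_compose_mult)
  hence "sect 0 (fps_X * xif * f) * (8 * w1 ^ 3 * Xf) = fps_X * S * (8 * w1 ^ 3 * Xf)"
  proof -
    have "t * (8 * W * X) = q * S * (8 * W * X)"
      if "8 * W * t = A" "X * A = (X - 1) * S" "X * (1 - 8 * q * W) = 1" for t W X q :: "rat fps"
    proof -
      have "t * (8 * W * X) = (X - X * (1 - 8 * q * W)) * S"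
        unfolding that(3) that(2) [symmetric] that(1) [symmetric] by algebra
      thus ?thesis by algebra
    qed
    from this[OF \<open>_ = A\<close> assms(2) Xf_w1] show ?thesis .
  qed
  thus ?thesis by (rule mult_right_cancelD) (simp add: w1_nonzero Xf_nonzero)
qed

text \<open>The exponent 0 is no row of the matrix, but it starts the recurrence from which the
  third row is obtained.\<close>

lemma sect_xif: "sect 0 (fps_X * xif * 1) = fps_X * (9 * Xf)"
proof (rule sect_xif_eqI)
  show "8 * (fps_X * xif * w3 ^ 3 * 1) =
     ((9 * Xf - 9) oo fps_X ^ 3) + ((18 * Xf - 10) oo fps_X ^ 3) * pp + ((36 * Xf - 4) oo fps_X ^ 3) * pp ^ 2"
    using reduction_h[OF Yf_pp xif_pp] by (simp add: compose_simps)
qed algebra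

lemma sect_xif_Xf: "sect 0 (fps_X * xif * Xf) = fps_X * (-9 * Xf + 252 * Xf ^ 2 - 891 * Xf ^ 3 + 729 * Xf ^ 4)"
proof (rule sect_xif_eqI)
  show "8 * (fps_X * xif * w3 ^ 3 * Xf) =
      ((9 - 261 * Xf + 1143 * Xf ^ 2 - 1620 * Xf ^ 3 + 729 * Xf ^ 4) oo fps_X ^ 3)
      + ((2 - 228 * Xf + 1530 * Xf ^ 2 - 2754 * Xf ^ 3 + 1458 * Xf ^ 4) oo fps_X ^ 3) * pp
      + ((-156 * Xf + 1872 * Xf ^ 2 - 4536 * Xf ^ 3 + 2916 * Xf ^ 4) oo fps_X ^ 3) * pp ^ 2"
    using reduction_hX[OF Yf_pp reduction_X[OF Yf_pp Xf_pp] reduction_h[OF Yf_pp xif_pp]]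
    by (simp add: compose_simps)
qed algebra

lemma sect_xif_Xf2:
  "sect 0 (fps_X * xif * Xf ^ 2) = fps_X *
     (Xf - 378 * Xf ^ 2 + 8613 * Xf ^ 3 - 54675 * Xf ^ 4 + 138510 * Xf ^ 5 - 150903 * Xf ^ 6 + 59049 * Xf ^ 7)"
proof (rule sect_xif_eqI)
  show "8 * (fps_X * xif * w3 ^ 3 * Xf ^ 2) =
     ((-1 + 379 * Xf - 8991 * Xf ^ 2 + 63288 * Xf ^ 3 - 193185 * Xf ^ 4
        + 289413 * Xf ^ 5 - 209952 * Xf ^ 6 + 59049 * Xf ^ 7) oo fps_X ^ 3)
      + ((170 * Xf - 7344 * Xf ^ 2 + 70848 * Xf ^ 3 - 266328 * Xf ^ 4 + 465102 * Xf ^ 5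
        - 380538 * Xf ^ 6 + 118098 * Xf ^ 7) oo fps_X ^ 3) * pp
      + ((52 * Xf - 5184 * Xf ^ 2 + 73332 * Xf ^ 3 - 350892 * Xf ^ 4 + 729000 * Xf ^ 5
        - 682344 * Xf ^ 6 + 236196 * Xf ^ 7) oo fps_X ^ 3) * pp ^ 2"
    using reduction_hX2[OF Yf_pp reduction_X[OF Yf_pp Xf_pp]
      reduction_hX[OF Yf_pp reduction_X[OF Yf_pp Xf_pp] reduction_h[OF Yf_pp xif_pp]]]
    by (simp add: compose_simps)
qed algebra

subsection \<open>The matrices\<close>

declare recmat.simps [simp del]

lemma recmat_nonpos: "j \<le> 0 \<Longrightarrow> recmat rows i j = 0"
  by (simp add: recmat.simps)

lemma recmat_rec:
  assumes "i \<ge> 1"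
  shows "recmat rows (i + 3) j =
    (if j \<le> 0 then 0 else
       30 * recmat rows (i + 2) (j - 1) - 108 * recmat rows (i + 2) (j - 2)
         + 81 * recmat rows (i + 2) (j - 3) - 12 * recmat rows (i + 1) (j - 1)
         + 9 * recmat rows (i + 1) (j - 2) + recmat rows i (j - 1))"
  using assms by (subst recmat.simps) (simp add: numeral_eq_Suc)

lemma nat_induct_three [consumes 1, case_names 1 2 3 step]:
  assumes "i \<ge> 1" "P 1" "P 2" "P 3"
    "\<And>i. i \<ge> 1 \<Longrightarrow> P i \<Longrightarrow> P (i + 1) \<Longrightarrow> P (i + 2) \<Longrightarrow> P (i + 3)"
  shows "P (i :: nat)"
  using assms(1)
proof (induction i rule: less_induct)
  case (less i)
  show ?case
  proof (cases "i \<le> 3")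
    case True
    with less.prems have "i = 1 \<or> i = 2 \<or> i = 3" by auto
    thus ?thesis using assms by auto
  next
    case False
    then obtain k where "i = k + 3" "k \<ge> 1"
      by (metis One_nat_def Suc_leI add.commute less_imp_add_positive not_le)
    thus ?thesis using assms(5)[of k] less.IH by simp
  qed
qed

text \<open>The two vanishing conditions ensure that no term is lost at either end of the
  range.\<close>

lemma sum_shift:
  fixes f :: "int \<Rightarrow> int" and x :: "'a::comm_ring_1"
  assumes "\<And>j. j \<le> 0 \<Longrightarrow> f j = 0" "\<And>j. j > K - int d \<Longrightarrow> f j = 0"
  shows "(\<Sum>j\<in>{1..K}. of_int (f (j - int d)) * x ^ nat j) = x ^ d * (\<Sum>j\<in>{1..K}. of_int (f j) * x ^ nat j)"
proof -
  have "(\<Sum>j\<in>{1..K}. of_int (f (j - int d)) * x ^ nat j)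
      = (\<Sum>j\<in>{1 - int d..K - int d}. of_int (f j) * x ^ nat (j + int d))"
    by (rule sum.reindex_bij_witness[of _ "\<lambda>j. j + int d" "\<lambda>j. j - int d"]) auto
  also have "\<dots> = (\<Sum>j\<in>{1..K - int d}. of_int (f j) * x ^ nat (j + int d))"
    by (rule sum.mono_neutral_right) (auto simp: assms(1))
  also have "\<dots> = (\<Sum>j\<in>{1..K - int d}. x ^ d * (of_int (f j) * x ^ nat j))"
    by (rule sum.cong) (auto simp: nat_add_distrib power_add)
  also have "\<dots> = (\<Sum>j\<in>{1..K}. x ^ d * (of_int (f j) * x ^ nat j))"
    by (rule sum.mono_neutral_left) (auto simp: assms(2))
  finally show ?thesis by (simp add: sum_distrib_left)
qed

text \<open>The extra \<open>x\<close> reflects that columns are numbered from 1 and list positions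
  from 0.\<close>

lemma sum_init_row:
  fixes x :: "'a::comm_ring_1"
  assumes "1 \<le> i" "i \<le> length rows" "int (length (rows ! (i - 1))) \<le> K"
  shows "(\<Sum>j\<in>{1..K}. of_int (init_row rows i j) * x ^ nat j) = x * horner_sum of_int x (rows ! (i - 1))"
proof -
  let ?r = "rows ! (i - 1)"
  have "(\<Sum>j\<in>{1..K}. of_int (init_row rows i j) * x ^ nat j)
      = (\<Sum>j\<in>{1..int (length ?r)}. of_int (init_row rows i j) * x ^ nat j)"
    by (rule sum.mono_neutral_right) (use assms in \<open>auto simp: init_row_def\<close>)
  also have "\<dots> = (\<Sum>k<length ?r. of_int (?r ! k) * x ^ Suc k)"
    by (rule sum.reindex_bij_witness[of _ "\<lambda>k. int k + 1" "\<lambda>j. nat (j - 1)"])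
       (use assms in \<open>auto simp: init_row_def nat_diff_distrib nat_add_distrib
          simp flip: power_Suc\<close>)
  finally show ?thesis by (simp add: horner_sum_eq_sum sum_distrib_left lessThan_atLeast0 ac_simps)
qed

text \<open>The list index is one less than the row number, so row \<open>i\<close> has at most
  \<open>3 i + 1\<close> entries, a bound shared by both matrices.\<close>

locale init_rows =
  fixes rows :: "int list list"
  assumes len: "length rows = 3"
    and len_row: "\<And>i. i < 3 \<Longrightarrow> length (rows ! i) \<le> 3 * i + 4"
begin

text \<open>The recurrence shifts columns by at most 3, 2 and 1 from the rows one, two and three
  above, so the bound grows by 3 per row.\<close>

lemma recmat_eq_0: "i \<ge> 1 \<Longrightarrow> j > 3 * int i + 1 \<Longrightarrow> recmat rows i j = 0"
proof (induction i arbitrary: j rule: nat_induct_three)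
  case (step i)
  thus ?case by (subst recmat_rec) auto
qed (use len len_row[of 0] len_row[of 1] len_row[of 2] in \<open>auto simp: recmat.simps init_row_def\<close>)

text \<open>The row polynomials obey the recurrence of \<open>s\<close> because a column shift is
  multiplication by a power of \<open>x\<close>. A range \<open>{1..K}\<close> common to all rows
  lets the sums be combined termwise.\<close>

lemma recmat_sum:
  fixes s :: "nat \<Rightarrow> 'a::comm_ring_1"
  assumes "i \<ge> 1" "K \<ge> 3 * int i + 1"
    and s: "s 1 = x * horner_sum of_int x (rows ! 0)"
      "s 2 = x * horner_sum of_int x (rows ! 1)" "s 3 = x * horner_sum of_int x (rows ! 2)"
    and rec: "\<And>i. i \<ge> 1 \<Longrightarrow> s (i + 3) = (30 * x - 108 * x ^ 2 + 81 * x ^ 3) * s (i + 2)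
       + (9 * x ^ 2 - 12 * x) * s (i + 1) + x * s i"
  shows "s i = (\<Sum>j\<in>{1..K}. of_int (recmat rows i j) * x ^ nat j)"
  using assms(1,2)
proof (induction i arbitrary: K rule: nat_induct_three)
  case (step i)
  let ?R = "\<lambda>i d. \<Sum>j\<in>{1..K}. of_int (recmat rows i (j - int d)) * x ^ nat j"
  have sh: "?R i' d = x ^ d * s i'"
    if "i' \<ge> 1" "s i' = (\<Sum>j\<in>{1..K}. of_int (recmat rows i' j) * x ^ nat j)" "K - int d \<ge> 3 * int i' + 1" for i' d
    unfolding that(2)
    by (rule sum_shift) (use that(1,3) in \<open>auto simp: recmat_nonpos recmat_eq_0\<close>)
  have "(\<Sum>j\<in>{1..K}. of_int (recmat rows (i + 3) j) * x ^ nat j) =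
     (\<Sum>j\<in>{1..K}. of_int (30 * recmat rows (i + 2) (j - int 1) - 108 * recmat rows (i + 2) (j - int 2)
         + 81 * recmat rows (i + 2) (j - int 3) - 12 * recmat rows (i + 1) (j - int 1)
         + 9 * recmat rows (i + 1) (j - int 2) + recmat rows i (j - int 1)) * x ^ nat j)"
    by (rule sum.cong) (use step.hyps in \<open>auto simp: recmat_rec\<close>)
  also have "\<dots> = 30 * ?R (i + 2) 1 - 108 * ?R (i + 2) 2 + 81 * ?R (i + 2) 3 - 12 * ?R (i + 1) 1
      + 9 * ?R (i + 1) 2 + ?R i 1"
    unfolding sum_distrib_left sum.distrib [symmetric] sum_subtractf [symmetric]
    by (rule sum.cong) (simp_all add: algebra_simps)
  also have "?R (i + 2) 1 = x ^ 1 * s (i + 2)"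
    by (rule sh) (use step in auto)
  also have "?R (i + 2) 2 = x ^ 2 * s (i + 2)"
    by (rule sh) (use step in auto)
  also have "?R (i + 2) 3 = x ^ 3 * s (i + 2)"
    by (rule sh) (use step in auto)
  also have "?R (i + 1) 1 = x ^ 1 * s (i + 1)"
    by (rule sh) (use step in auto)
  also have "?R (i + 1) 2 = x ^ 2 * s (i + 1)"
    by (rule sh) (use step in auto)
  also have "?R i 1 = x ^ 1 * s i"
    by (rule sh) (use step in auto)
  finally show ?case unfolding rec[OF step.hyps] by (simp add: algebra_simps)
next
  case 1
  have "(\<Sum>j\<in>{1..K}. of_int (recmat rows 1 j) * x ^ nat j) = (\<Sum>j\<in>{1..K}. of_int (init_row rows 1 j) * x ^ nat j)"
    by (rule sum.cong) (auto simp: recmat.simps)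
  thus ?case using 1 s len len_row[of 0] by (simp add: sum_init_row)
next
  case 2
  have "(\<Sum>j\<in>{1..K}. of_int (recmat rows 2 j) * x ^ nat j) = (\<Sum>j\<in>{1..K}. of_int (init_row rows 2 j) * x ^ nat j)"
    by (rule sum.cong) (auto simp: recmat.simps)
  thus ?case using 2 s len len_row[of 1] by (simp add: sum_init_row)
next
  case 3
  have "(\<Sum>j\<in>{1..K}. of_int (recmat rows 3 j) * x ^ nat j) = (\<Sum>j\<in>{1..K}. of_int (init_row rows 3 j) * x ^ nat j)"
    by (rule sum.cong) (auto simp: recmat.simps)
  thus ?case using 3 s len len_row[of 2] by (simp add: sum_init_row)
qed

lemma recmat_support_sum:
  fixes s :: "nat \<Rightarrow> 'a::comm_ring_1"
  assumes "i \<ge> 1"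
    and "s 1 = x * horner_sum of_int x (rows ! 0)"
      "s 2 = x * horner_sum of_int x (rows ! 1)" "s 3 = x * horner_sum of_int x (rows ! 2)"
    and "\<And>i. i \<ge> 1 \<Longrightarrow> s (i + 3) = (30 * x - 108 * x ^ 2 + 81 * x ^ 3) * s (i + 2)
       + (9 * x ^ 2 - 12 * x) * s (i + 1) + x * s i"
  shows "s i = (\<Sum>j\<in>{j. j \<ge> 1 \<and> recmat rows i j \<noteq> 0}. of_int (recmat rows i j) * x ^ nat j)"
proof -
  have le: "j \<le> 3 * int i + 1" if "recmat rows i j \<noteq> 0" for j
    using recmat_eq_0[OF assms(1), of j] that by linarith
  have "s i = (\<Sum>j\<in>{1..3 * int i + 1}. of_int (recmat rows i j) * x ^ nat j)"
    by (rule recmat_sum) (use assms in auto)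
  also have "\<dots> = (\<Sum>j\<in>{j. j \<ge> 1 \<and> recmat rows i j \<noteq> 0}. of_int (recmat rows i j) * x ^ nat j)"
    by (rule sum.mono_neutral_right) (auto simp: le)
  finally show ?thesis .
qed

end

subsection \<open>The operator \<open>U\<close> on Laurent series\<close>

lemma fps_to_fls_sum: "fps_to_fls (sum f A) = (\<Sum>x\<in>A. fps_to_fls (f x :: 'a::comm_ring_1 fps))"
  by (induction A rule: infinite_finite_induct) (auto simp: fps_to_fls_plus)

lemma Uop_nth: "fls_nth (Uop f) n = fls_nth f (3 * n)"
  by (simp add: Uop.rep_eq)

lemma Uop_fps: "Uop (fps_to_fls f) = fps_to_fls (sect 0 f)"
  by (rule fls_eqI) (auto simp: Uop_nth sect_def nat_mult_distrib)

lemma Xfun_eq: "Xfun = fps_to_fls Xf"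
  by (simp add: Xfun_def Xf_def)

text \<open>The pole is removed by passing to \<open>q^3 \<xi>\<close>, and
  \<open>U(q^3 g) = q U(g)\<close> turns the shift by 3 into a shift by 1.\<close>

lemma Uop_xi:
  assumes "sect 0 (fps_X * xif * Xf ^ i) = fps_X * S"
  shows "Uop (xi * Xfun ^ i) = fps_to_fls S"
proof -
  have "xi * Xfun ^ i = fls_shift 2 (fps_to_fls (xif * Xf ^ i))"
    unfolding xi_def xif_def [symmetric] Xfun_eq
    by (simp add: fls_times_fps_to_fls fps_to_fls_power fls_shifted_times_simps)
  also have "\<dots> = fls_shift 3 (fps_to_fls (fps_X * xif * Xf ^ i))"
  proof (rule fls_eqI)
    fix n
    have "nat (n + 3) - 1 = nat (n + 2)" by arith
    thus "fls_nth (fls_shift 2 (fps_to_fls (xif * Xf ^ i))) n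
        = fls_nth (fls_shift 3 (fps_to_fls (fps_X * xif * Xf ^ i))) n"
      by (auto simp: mult.assoc)
  qed
  also have "Uop \<dots> = fls_shift 1 (Uop (fps_to_fls (fps_X * xif * Xf ^ i)))"
    by (rule fls_eqI) (simp add: Uop_nth)
  also have "\<dots> = fls_shift 1 (fps_to_fls (fps_X * S))"
    by (simp only: Uop_fps assms)
  also have "\<dots> = fps_to_fls S"
    by (rule fls_eqI) (auto simp: nat_add_distrib)
  finally show ?thesis .
qed

theorem theorem2p5:
  fixes i :: nat
  assumes "i \<ge> 1"
  shows "Uop (Xfun ^ i) =
           (\<Sum>j\<in>{j::int. j \<ge> 1 \<and> amat i j \<noteq> 0}. of_int (amat i j) * Xfun ^ nat j) \<and>
         Uop (xi * Xfun ^ i) =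
           (\<Sum>j\<in>{j::int. j \<ge> 1 \<and> bmat i j \<noteq> 0}. of_int (bmat i j) * Xfun ^ nat j)"
proof
  have to_fls: "fps_to_fls (\<Sum>j\<in>A. of_int (m j) * Xf ^ nat j) = (\<Sum>j\<in>A. of_int (m j) * Xfun ^ nat j)"
    for A :: "int set" and m :: "int \<Rightarrow> int"
    by (simp add: fps_to_fls_sum Xfun_eq fls_times_fps_to_fls fps_to_fls_power)
  let ?a = "[[10, -36, 27], [-8, 306, -2160, 5508, -5832, 2187],
    [1, -360, 10566, -99144, 423549, -944784, 1141614, -708588, 177147]] :: int list list"
  let ?b = "[[-9, 252, -891, 729], [1, -378, 8613, -54675, 138510, -150903, 59049],
    [0, 147, -14553, 312255, -2617839, 10764414, -23914845, 29288304, -18600435, 4782969]] :: int list list"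
  have three: "k = 0 \<or> k = 1 \<or> k = 2" if "k < 3" for k :: nat using that by auto
  interpret a: init_rows ?a
    by standard (use three in force)+
  interpret b: init_rows ?b
    by standard (use three in force)+
  have "sect 0 (Xf ^ i) = (\<Sum>j\<in>{j. j \<ge> 1 \<and> recmat ?a i j \<noteq> 0}. of_int (recmat ?a i j) * Xf ^ nat j)"
  proof (rule a.recmat_support_sum[OF assms, where s = "\<lambda>i. sect 0 (Xf ^ i)"])
    \<comment> \<open>The third row follows from the recurrence started at exponent 0, where
      \<open>U(1) = 1\<close>.\<close>
    have "sect 0 (Xf ^ 3) = (30 * Xf - 108 * Xf ^ 2 + 81 * Xf ^ 3) * sect 0 (Xf ^ 2)
       + (9 * Xf ^ 2 - 12 * Xf) * sect 0 Xf + Xf"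
      using sect_Xf_rec[of 1 0] by (simp add: sect_1 numeral_2_eq_2)
    also have "\<dots> = Xf * horner_sum of_int Xf (?a ! 2)"
      unfolding sect_Xf sect_Xf2 by simp algebra
    finally show "sect 0 (Xf ^ 3) = Xf * horner_sum of_int Xf (?a ! 2)" .
    show "sect 0 (Xf ^ 1) = Xf * horner_sum of_int Xf (?a ! 0)"
      by (simp add: sect_Xf) algebra
    show "sect 0 (Xf ^ 2) = Xf * horner_sum of_int Xf (?a ! 1)"
      by (simp add: sect_Xf2) algebra
  qed (use sect_Xf_rec[of 1] in simp)
  thus "Uop (Xfun ^ i) = (\<Sum>j\<in>{j::int. j \<ge> 1 \<and> amat i j \<noteq> 0}. of_int (amat i j) * Xfun ^ nat j)"
    unfolding amat_def to_fls [symmetric] unfolding Xfun_eq fps_to_fls_power [symmetric] Uop_fps by (simp only:)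
  \<comment> \<open>Since \<open>q \<cdot> xif = q^3 \<xi>\<close>, division by \<open>q\<close>
    after the trisection leaves \<open>U(\<xi> X^k)\<close>.\<close>
  define s where "s k = fps_shift 1 (sect 0 (fps_X * xif * Xf ^ k))" for k
  \<comment> \<open>The shift loses nothing: the factor \<open>fps_X\<close> makes the constant
    coefficient zero.\<close>
  have s0: "sect 0 (fps_X * xif * Xf ^ k) = fps_X * s k" for k
    by (rule fps_ext) (simp add: s_def sect_def)
  have s_rec: "s (k + 3) = (30 * Xf - 108 * Xf ^ 2 + 81 * Xf ^ 3) * s (k + 2)
       + (9 * Xf ^ 2 - 12 * Xf) * s (k + 1) + Xf * s k" for k
  proof -
    have "fps_X * s (k + 3) = fps_X * ((30 * Xf - 108 * Xf ^ 2 + 81 * Xf ^ 3) * s (k + 2)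
       + (9 * Xf ^ 2 - 12 * Xf) * s (k + 1) + Xf * s k)"
      using sect_Xf_rec[of "fps_X * xif" k] unfolding s0 by (simp only: distrib_left mult.left_commute)
    thus ?thesis by simp
  qed
  have s012: "s 0 = 9 * Xf" "s 1 = -9 * Xf + 252 * Xf ^ 2 - 891 * Xf ^ 3 + 729 * Xf ^ 4"
    "s 2 = Xf - 378 * Xf ^ 2 + 8613 * Xf ^ 3 - 54675 * Xf ^ 4 + 138510 * Xf ^ 5 - 150903 * Xf ^ 6 + 59049 * Xf ^ 7"
    using sect_xif sect_xif_Xf sect_xif_Xf2 s0[of 0] s0[of 1] s0[of 2] by simp_all
  have "s i = (\<Sum>j\<in>{j. j \<ge> 1 \<and> recmat ?b i j \<noteq> 0}. of_int (recmat ?b i j) * Xf ^ nat j)"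
  proof (rule b.recmat_support_sum[OF assms, where s = s])
    \<comment> \<open>Again the third row comes from the recurrence at exponent 0, now with
      \<open>s 0 = 9 * Xf\<close>.\<close>
    have "s 3 = (30 * Xf - 108 * Xf ^ 2 + 81 * Xf ^ 3) * s 2 + (9 * Xf ^ 2 - 12 * Xf) * s 1 + Xf * s 0"
      using s_rec[of 0] by (simp add: numeral_2_eq_2)
    also have "\<dots> = Xf * horner_sum of_int Xf (?b ! 2)"
      unfolding s012 by simp algebra
    finally show "s 3 = Xf * horner_sum of_int Xf (?b ! 2)" .
    show "s 1 = Xf * horner_sum of_int Xf (?b ! 0)"
      unfolding s012 by simp algebra
    show "s 2 = Xf * horner_sum of_int Xf (?b ! 1)"
      unfolding s012 by simp algebra
  qed (rule s_rec)
  thus "Uop (xi * Xfun ^ i) = (\<Sum>j\<in>{j::int. j \<ge> 1 \<and> bmat i j \<noteq> 0}. of_int (bmat i j) * Xfun ^ nat j)"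
    unfolding bmat_def to_fls [symmetric] Uop_xi[OF s0] by (simp only:)
qed

end
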